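(* For every integer $k\ge 1$ there is $n_0$ such that for all $n\ge n_0$, $\mathrm{ex}_4(n,\mathcal{S}^4C_{2k+1})\le \frac{n}{16}\binom{n}{3}$. Moreover, this bound is sharp for infinitely many $n$, i.e., there are infinitely many $n$ for which $\mathrm{ex}_4(n,\mathcal{S}^4C_{2k+1})= \frac{n}{16}\binom{n}{3}$.
   Context: $C_{2k+1}$ is the cycle of length $2k+1$. For a graph $F$, the $4$-uniform suspension $\mathcal{S}^4F$ is the $4$-uniform hypergraph obtained from $F$ by adding $2$ new vertices and adding both of them to every edge of $F$. $\mathrm{ex}_4(n,\mathcal{F})$ denotes the maximum number of hyperedges in an $n$-vertex $4$-uniform hypergraph not containing $\mathcal{F}$ as a subhypergraph. *)

theory Defs
  imports Complex_Main "HOL-Library.Ramsey"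
begin

text \<open>A hypergraph is a pair of a vertex set and an edge set; a graph is a 2-uniform hypergraph.\<close>

type_synonym 'a hypergraph = "'a set \<times> 'a set set"

abbreviation verts :: "'a hypergraph \<Rightarrow> 'a set" where
  "verts H \<equiv> fst H"

abbreviation edges :: "'a hypergraph \<Rightarrow> 'a set set" where
  "edges H \<equiv> snd H"

definition uniform_hypergraph :: "nat \<Rightarrow> 'a hypergraph \<Rightarrow> bool" where
  "uniform_hypergraph r H \<longleftrightarrow> finite (verts H) \<and> edges H \<subseteq> [verts H]\<^bsup>r\<^esup>"

text \<open>Containment is as a not necessarily induced subhypergraph, up to isomorphism.\<close>

definition contains_copy :: "'a hypergraph \<Rightarrow> 'b hypergraph \<Rightarrow> bool" where
  "contains_copy H F \<longleftrightarrow>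
     (\<exists>f. inj_on f (verts F) \<and> f ` verts F \<subseteq> verts H \<and> (\<forall>e \<in> edges F. f ` e \<in> edges H))"

text \<open>
  Vertices in \<open>nat\<close> are no restriction, since only finite hypergraphs are considered.
  The maximum is over a set of numbers bounded by \<open>n choose r\<close>, and that set contains 0
  as soon as \<open>F\<close> has an edge.
\<close>

definition ex :: "nat \<Rightarrow> nat \<Rightarrow> 'b hypergraph \<Rightarrow> nat" where
  "ex r n F = Max {card (edges H) | H :: nat hypergraph.
     uniform_hypergraph r H \<and> card (verts H) = n \<and> \<not> contains_copy H F}"

text \<open>A cycle of length \<open>m\<close> in the usual sense for \<open>m \<ge> 3\<close>.\<close>

definition cycle_graph :: "nat \<Rightarrow> nat hypergraph" where
  "cycle_graph m = ({..<m}, {{i, (i + 1) mod m} | i. i < m})"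

text \<open>
  The \<open>r\<close>-uniform suspension of a graph: the disjoint sum with \<open>{..<r - 2}\<close> supplies the
  \<open>r - 2\<close> new vertices, all of which are added to every edge.
\<close>

definition suspension :: "nat \<Rightarrow> 'a hypergraph \<Rightarrow> ('a + nat) hypergraph" where
  "suspension r F = (verts F <+> {..<r - 2}, {e <+> {..<r - 2} | e. e \<in> edges F})"

end

(*
  Let d(T) be the codegree of a triple T. If any two vertices a, b have a triangle-free link, then
  each edge e and vertex z admit at most one triple T of e with T + z an edge, so the sum of d(T)^2
  over all triples is at most n |E|, and Cauchy-Schwarz gives the bound. In general the link of a, b
  is only free of odd cycles of length 2k+1, and each triangle in it costs something; but the
  Cauchy-Schwarz defect, the sum of (d(T) - n/4)^2, pays for it link by link. Indeed, a link with few
  vertices of degree far from n/4 becomes a (2k+1)-cycle-free graph of large minimum degree when these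
  are deleted, hence triangle-free, so that every triangle meets a deleted vertex, and a vertex lies in
  only O(n) triangles because its neighbourhood has no path on 2k vertices.

  Equality holds for the quadruples on which the Pfaffian of a skew conference matrix is +3 or -3:
  links of pairs are bipartite, and orthogonality of the rows makes every codegree equal to n/4. Such
  matrices of order 2^m arise by doubling.
*)
theory Submission
  imports Defs
begin

subsection \<open>Triangles in graphs without a given odd cycle\<close>

text \<open>A Bonferroni-type bound: a new set overlaps the union of the earlier ones in at most
  \<open>card S * L\<close> elements. The coefficient \<open>card S * card S\<close> is a crude
  replacement for the number of pairs.\<close>

lemma sum_card_le_card_Union:
  assumes "finite S" "\<And>v. v \<in> S \<Longrightarrow> finite (N v)"
    and "\<And>u v. \<lbrakk>u \<in> S; v \<in> S; u \<noteq> v\<rbrakk> \<Longrightarrow> card (N u \<inter> N v) \<le> L"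
  shows "(\<Sum>v\<in>S. card (N v)) \<le> card (\<Union>v\<in>S. N v) + card S * card S * L"
  using assms
proof (induction S)
  case empty
  then show ?case by simp
next
  case (insert x S)
  let ?U = "\<Union>v\<in>S. N v"
  have "card (N x \<inter> ?U) = card (\<Union>v\<in>S. N x \<inter> N v)"
    by (rule arg_cong[where f = card]) blast
  also have "\<dots> \<le> (\<Sum>v\<in>S. card (N x \<inter> N v))"
    by (rule card_UN_le) (use insert in auto)
  also have "\<dots> \<le> (\<Sum>v\<in>S. L)"
    by (rule sum_mono) (use insert in auto)
  finally have 1: "card (N x \<inter> ?U) \<le> card S * L" by simp
  have fin: "finite (N x)" "finite ?U"
    using insert by auto
  have 2: "card (N x) + card ?U = card (N x \<union> ?U) + card (N x \<inter> ?U)"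
    by (rule card_Un_Int) (use fin in auto)
  have 3: "(\<Sum>v\<in>S. card (N v)) \<le> card ?U + card S * card S * L"
    by (rule insert.IH) (use insert in auto)
  have "(\<Sum>v\<in>insert x S. card (N v)) = card (N x) + (\<Sum>v\<in>S. card (N v))"
    using insert by simp
  also have "\<dots> \<le> card (N x \<union> ?U) + card S * L + card S * card S * L"
    using 1 2 3 by linarith
  also have "\<dots> \<le> card (N x \<union> ?U) + card (insert x S) * card (insert x S) * L"
    using insert by (simp add: algebra_simps)
  finally show ?case by simp
qed

section \<open>Paths, cycles and triangles at a vertex\<close>

text \<open>The relation \<open>R\<close> lives on the whole type, so an induced subgraph is
  obtained by shrinking \<open>W\<close> while keeping \<open>R\<close>.\<close>

locale finite_graph =
  fixes W :: "'a set" and R :: "'a \<Rightarrow> 'a \<Rightarrow> bool"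
  assumes fin: "finite W"
    and sym: "R x y \<Longrightarrow> R y x"
    and irrefl: "\<not> R x x"
begin

definition nbrs :: "'a \<Rightarrow> 'a set" where
  "nbrs v = {w \<in> W. R v w}"

text \<open>The parameter counts vertices, not edges.\<close>

definition has_path :: "nat \<Rightarrow> bool" where
  "has_path l \<longleftrightarrow> (\<exists>xs. length xs = l \<and> distinct xs \<and> set xs \<subseteq> W \<and> successively R xs)"

definition has_cycle :: "nat \<Rightarrow> bool" where
  "has_cycle l \<longleftrightarrow> (\<exists>xs. length xs = l \<and> distinct xs \<and> set xs \<subseteq> W \<and> successively R xs
     \<and> R (last xs) (hd xs))"

text \<open>The pairs are ordered, so every triangle at \<open>v\<close> is counted twice.\<close>

definition triangles_at :: "'a \<Rightarrow> ('a \<times> 'a) set" where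
  "triangles_at v = {(y, z) \<in> W \<times> W. R v y \<and> R v z \<and> R y z}"

lemma finite_nbrs [simp]: "finite (nbrs v)"
  using fin by (simp add: nbrs_def)

lemma nbrs_subset: "nbrs v \<subseteq> W"
  by (auto simp: nbrs_def)

text \<open>Greedy extension at the head: a path on fewer than \<open>p\<close> vertices cannot
  contain all neighbours of its first vertex.\<close>

lemma has_path_of_min_degree:
  assumes "W \<noteq> {}" "\<And>v. v \<in> W \<Longrightarrow> p \<le> card (nbrs v)"
  shows "has_path p"
proof -
  have "has_path l" if "l \<le> p" for l
    using that
  proof (induction l)
    case 0
    then show ?case by (auto simp: has_path_def)
  next
    case (Suc l)
    then obtain xs where xs: "length xs = l" "distinct xs" "set xs \<subseteq> W" "successively R xs"
      by (auto simp: has_path_def)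
    show ?case
    proof (cases "xs = []")
      case True
      obtain w where "w \<in> W" using assms(1) by blast
      with True xs show ?thesis
        unfolding has_path_def by (intro exI[of _ "[w]"]) auto
    next
      case False
      then have hd: "hd xs \<in> W" using xs(3) by auto
      have "card (set xs) < card (nbrs (hd xs))"
        using assms(2)[OF hd] Suc.prems xs distinct_card[of xs] by simp
      then obtain w where w: "w \<in> nbrs (hd xs)" "w \<notin> set xs"
        by (metis card_mono finite_set leD subsetI)
      then have "w \<in> W" "R w (hd xs)" by (auto simp: nbrs_def intro: sym)
      with w xs show ?thesis
        unfolding has_path_def
        by (intro exI[of _ "w # xs"]) (auto simp: successively_Cons)
    qed
  qed
  then show ?thesis by simp
qed

end

text \<open>Some vertex has degree below \<open>p\<close>, since otherwise a path on
  \<open>p\<close> vertices exists. Deleting it loses fewer than \<open>2 * p\<close> ordered pairs,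
  and induction applies to the rest.\<close>

lemma card_adjacent_pairs_le:
  assumes "finite_graph W R" "\<not> finite_graph.has_path W R p"
  shows "card {(y, z) \<in> W \<times> W. R y z} \<le> 2 * p * card W"
  using assms
proof (induction "card W" arbitrary: W)
  case 0
  then interpret finite_graph W R by simp
  have "W = {}" using 0 fin by simp
  then show ?case by simp
next
  case (Suc n)
  then interpret finite_graph W R by simp
  have "W \<noteq> {}" using Suc.hyps(2) by auto
  then obtain v where v: "v \<in> W" "card (nbrs v) < p"
    using has_path_of_min_degree Suc.prems(2) by (meson not_le)
  let ?W = "W - {v}"
  have card: "card ?W = n" using Suc.hyps(2) v fin by simp
  interpret G: finite_graph ?W R
    by unfold_locales (use fin sym irrefl in auto)
  have "\<not> G.has_path p"
    using Suc.prems(2) by (auto simp: G.has_path_def has_path_def)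
  then have IH: "card {(y, z) \<in> ?W \<times> ?W. R y z} \<le> 2 * p * n"
    using Suc.hyps(1)[of ?W] card G.finite_graph_axioms by simp
  have "{(y, z) \<in> W \<times> W. R y z} \<subseteq>
      {(y, z) \<in> ?W \<times> ?W. R y z} \<union> ({v} \<times> nbrs v \<union> nbrs v \<times> {v})"
    by (auto simp: nbrs_def intro: sym)
  then have "card {(y, z) \<in> W \<times> W. R y z} \<le>
      card ({(y, z) \<in> ?W \<times> ?W. R y z} \<union> ({v} \<times> nbrs v \<union> nbrs v \<times> {v}))"
    by (rule card_mono[rotated]) (use fin in \<open>auto intro: finite_subset[of _ "W \<times> W"]\<close>)
  also have "\<dots> \<le> card {(y, z) \<in> ?W \<times> ?W. R y z} + card ({v} \<times> nbrs v \<union> nbrs v \<times> {v})"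
    by (rule card_Un_le)
  also have "card ({v} \<times> nbrs v \<union> nbrs v \<times> {v}) \<le> card ({v} \<times> nbrs v) + card (nbrs v \<times> {v})"
    by (rule card_Un_le)
  also have "\<dots> = 2 * card (nbrs v)"
    by (simp add: card_cartesian_product)
  finally have "card {(y, z) \<in> W \<times> W. R y z} \<le> 2 * p * n + 2 * p"
    using IH v(2) by linarith
  then show ?case using Suc.hyps(2) by (simp flip: Suc.hyps(2))
qed

context finite_graph
begin

text \<open>A path on \<open>2 * k\<close> vertices inside the neighbourhood of \<open>v\<close>
  closes through \<open>v\<close> to a forbidden cycle. Hence the neighbourhood spans only linearly
  many edges, and these are the triangles at \<open>v\<close>.\<close>

lemma card_triangles_at_le:
  assumes "k \<ge> 1" "v \<in> W" "\<not> has_cycle (2 * k + 1)"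
  shows "card (triangles_at v) \<le> 4 * k * card W"
proof -
  interpret G: finite_graph "nbrs v" R
    by unfold_locales (use sym irrefl in auto)
  have "\<not> G.has_path (2 * k)"
  proof
    assume "G.has_path (2 * k)"
    then obtain xs where xs: "length xs = 2 * k" "distinct xs" "set xs \<subseteq> nbrs v" "successively R xs"
      by (auto simp: G.has_path_def)
    then have ne: "xs \<noteq> []" using assms(1) by auto
    have "set xs \<subseteq> W" "v \<notin> set xs" using xs(3) irrefl by (auto simp: nbrs_def)
    moreover have "R v (hd xs)" "R (last xs) v"
      using hd_in_set[OF ne] last_in_set[OF ne] xs(3) by (auto simp: nbrs_def dest: sym)
    ultimately have "has_cycle (2 * k + 1)"
      using xs ne assms(2) unfolding has_cycle_def
      by (intro exI[of _ "v # xs"]) (auto simp: successively_Cons)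
    with assms(3) show False by simp
  qed
  then have "card {(y, z) \<in> nbrs v \<times> nbrs v. R y z} \<le> 2 * (2 * k) * card (nbrs v)"
    by (rule card_adjacent_pairs_le[OF G.finite_graph_axioms])
  moreover have "{(y, z) \<in> nbrs v \<times> nbrs v. R y z} = triangles_at v"
    unfolding triangles_at_def nbrs_def by blast
  moreover have "2 * (2 * k) * card (nbrs v) \<le> 4 * k * card W"
    using card_mono[OF fin nbrs_subset[of v]] by (simp add: mult_le_mono)
  ultimately show ?thesis by (metis le_trans)
qed

section \<open>Large minimum degree excludes triangles\<close>

text \<open>Between consecutive entries of \<open>as\<close> a fresh common neighbour is inserted,
  working from the far end. There are at least \<open>L\<close> candidates, more than the forbidden
  and already used vertices together.\<close>

lemma alternating_path:
  assumes "as \<noteq> []" "distinct as" "set as \<subseteq> W" "set as \<inter> F = {}" "finite F"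
    and "successively (\<lambda>a b. L \<le> card (nbrs a \<inter> nbrs b)) as"
    and "card F + 2 * length as \<le> L"
  shows "\<exists>ps. length ps + 1 = 2 * length as \<and> distinct ps \<and> set ps \<subseteq> W - F \<and> successively R ps
    \<and> hd ps = hd as \<and> last ps = last as"
  using assms
proof (induction as arbitrary: F)
  case Nil
  then show ?case by simp
next
  case (Cons a as)
  show ?case
  proof (cases "as = []")
    case True
    then show ?thesis using Cons.prems by (intro exI[of _ "[a]"]) auto
  next
    case False
    \<comment> \<open>The path for the tail must avoid \<open>a\<close> too. The forbidden set grows
      by one while \<open>2 * length as\<close> drops by two, so the bound by \<open>L\<close>
      survives.\<close>
    let ?F = "insert a F"
    have cF: "card ?F = Suc (card F)" using Cons.prems by auto
    have "\<exists>ps. length ps + 1 = 2 * length as \<and> distinct ps \<and> set ps \<subseteq> W - ?F \<and> successively R ps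
      \<and> hd ps = hd as \<and> last ps = last as"
      by (rule Cons.IH) (use Cons.prems False cF in \<open>auto simp: successively_Cons\<close>)
    then obtain ps where ps: "length ps + 1 = 2 * length as" "distinct ps" "set ps \<subseteq> W - ?F"
      "successively R ps" "hd ps = hd as" "last ps = last as" by blast
    have ne: "ps \<noteq> []" using ps(1) False by (cases as) auto
    have "card (?F \<union> set ps) \<le> Suc (card F) + length ps"
      using card_Un_le[of ?F "set ps"] cF card_length[of ps] by linarith
    also have "\<dots> < L" using Cons.prems(7) ps(1) by simp
    also have "L \<le> card (nbrs a \<inter> nbrs (hd as))"
      using Cons.prems(6) False by (simp add: successively_Cons)
    finally obtain b where b: "b \<in> nbrs a \<inter> nbrs (hd as)" "b \<notin> ?F \<union> set ps"
      by (metis Cons.prems(5) List.finite_set card_mono finite.insertI finite_UnI leD subsetI)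
    then have "R a b" "R b (hd ps)" "b \<in> W" using ps(5) by (auto simp: nbrs_def intro: sym)
    with b ps ne False Cons.prems show ?thesis
      by (intro exI[of _ "a # b # ps"]) (auto simp: successively_Cons)
  qed
qed

(* By Ramsey's theorem, the common neighbourhood of u and v contains k vertices any two of which
   have many common neighbours; an alternating path through these has any prescribed even length. *)
lemma linked_path:
  assumes six: "\<And>S. \<lbrakk>S \<subseteq> W; card S = 6\<rbrakk> \<Longrightarrow> \<exists>p\<in>S. \<exists>q\<in>S. p \<noteq> q \<and> L \<le> card (nbrs p \<inter> nbrs q)"
    and ramsey: "\<And>(V :: 'a set) (E :: 'a set set). \<lbrakk>finite V; r \<le> card V\<rbrakk> \<Longrightarrow>
      \<exists>C\<subseteq>V. card C = k \<and> clique C E \<or> card C = 6 \<and> indep C E"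
    and uv: "u \<in> W - F" "v \<in> W - F" "u \<noteq> v"
    and F: "finite F" "card F + 2 + 2 * k \<le> L" "r + card F \<le> card (nbrs u \<inter> nbrs v)"
    and j: "1 \<le> j" "j \<le> k"
  shows "\<exists>ps. length ps = 2 * j + 1 \<and> distinct ps \<and> set ps \<subseteq> W - F \<and> successively R ps
    \<and> hd ps = u \<and> last ps = v"
proof -
  define A where "A = nbrs u \<inter> nbrs v - F"
  define E where "E = {{p, q} | p q. L \<le> card (nbrs p \<inter> nbrs q)}"
  have E_iff: "{p, q} \<in> E \<longleftrightarrow> L \<le> card (nbrs p \<inter> nbrs q)" for p q
    by (auto simp: E_def doubleton_eq_iff Int_commute)
  have "r \<le> card A"
    using diff_card_le_card_Diff[OF F(1), of "nbrs u \<inter> nbrs v"] F(3) by (simp add: A_def)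
  moreover have "finite A" by (simp add: A_def)
  ultimately obtain C where C: "C \<subseteq> A" "card C = k \<and> clique C E \<or> card C = 6 \<and> indep C E"
    using ramsey by meson
  have AW: "A \<subseteq> W" by (auto simp: A_def nbrs_def)
  \<comment> \<open>By \<open>six\<close>, every six vertices include two with many common
    neighbours, so Ramsey's theorem must yield the clique.\<close>
  have "\<not> (card C = 6 \<and> indep C E)"
    using six[of C] C(1) AW by (auto simp: indep_def E_iff)
  with C have cl: "card C = k" "clique C E" by auto
  have "finite C" using C(1) \<open>finite A\<close> finite_subset by blast
  then obtain cs where cs: "set cs = C" "distinct cs" using finite_distinct_list by blast
  then have lcs: "length cs = k" using cl distinct_card by fastforce
  \<comment> \<open>The alternating path through \<open>j\<close> clique vertices has
    \<open>2 * j - 1\<close> vertices; \<open>u\<close> and \<open>v\<close> at its ends make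
    \<open>2 * j + 1\<close>.\<close>
  define as where "as = take j cs"
  have as: "length as = j" "distinct as" "set as \<subseteq> C"
    using cs lcs j set_take_subset[of j cs] by (auto simp: as_def)
  then have ne: "as \<noteq> []" using j by auto
  have sorted: "sorted_wrt (\<lambda>a b. L \<le> card (nbrs a \<inter> nbrs b)) as"
    unfolding sorted_wrt_iff_nth_less
  proof (intro allI impI)
    fix i i' assume i: "i < i'" "i' < length as"
    then have "as ! i \<noteq> as ! i'" using as by (simp add: nth_eq_iff_index_eq)
    moreover have "as ! i \<in> C" "as ! i' \<in> C" using i as by auto
    ultimately show "L \<le> card (nbrs (as ! i) \<inter> nbrs (as ! i'))"
      using cl(2) by (simp add: clique_def E_iff)
  qed
  let ?F = "insert u (insert v F)"
  have "card ?F = card F + 2" using F uv by simp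
  moreover have "set as \<inter> ?F = {}" using as C(1) irrefl by (auto simp: A_def nbrs_def)
  ultimately have "\<exists>ps. length ps + 1 = 2 * length as \<and> distinct ps \<and> set ps \<subseteq> W - ?F
      \<and> successively R ps \<and> hd ps = hd as \<and> last ps = last as"
    using as ne F j C(1) AW successively_if_sorted_wrt[OF sorted]
    by (intro alternating_path[where L = L]) auto
  then obtain ps where ps: "length ps + 1 = 2 * length as" "distinct ps" "set ps \<subseteq> W - ?F"
    "successively R ps" "hd ps = hd as" "last ps = last as" by blast
  have "ps \<noteq> []" using ps(1) as(1) j by auto
  moreover have "hd as \<in> A" "last as \<in> A"
    using hd_in_set[OF ne] last_in_set[OF ne] as(3) C(1) by blast+
  then have "R u (hd ps)" "R (last ps) v"
    using ps(5,6) by (auto simp: A_def nbrs_def intro: sym[of v])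
  moreover have "u \<notin> set ps" "v \<notin> set ps" "set ps \<subseteq> W - F" "length ps + 2 = 2 * j + 1"
    using ps(1,3) as(1) by auto
  ultimately show ?thesis
    using ps(2,4) uv
    by (intro exI[of _ "u # ps @ [v]"]) (simp add: successively_Cons successively_append_iff)
qed

text \<open>Six neighbourhoods of size at least \<open>card W / 5\<close> have total size at least
  6/5 of \<open>card W\<close>. Pairwise intersections of at most \<open>L\<close> would bound the
  total by \<open>card W + 36 * L\<close>, which forces \<open>card W \<le> 180 * L\<close>.\<close>

lemma six_linked:
  assumes deg: "\<And>v. v \<in> W \<Longrightarrow> card W \<le> 5 * card (nbrs v)"
    and S: "S \<subseteq> W" "card S = 6" and W: "180 * L < card W"
  shows "\<exists>p\<in>S. \<exists>q\<in>S. p \<noteq> q \<and> L \<le> card (nbrs p \<inter> nbrs q)"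
proof (rule ccontr)
  assume neg: "\<not> ?thesis"
  have "finite S" using S fin finite_subset by blast
  have "6 * card W = (\<Sum>v\<in>S. card W)" using S by simp
  also have "\<dots> \<le> (\<Sum>v\<in>S. 5 * card (nbrs v))"
    by (rule sum_mono) (use deg S in auto)
  also have "\<dots> = 5 * (\<Sum>v\<in>S. card (nbrs v))" by (simp add: sum_distrib_left)
  also have "(\<Sum>v\<in>S. card (nbrs v)) \<le> card (\<Union>v\<in>S. nbrs v) + card S * card S * L"
  proof (rule sum_card_le_card_Union)
    show "card (nbrs u \<inter> nbrs v) \<le> L" if "u \<in> S" "v \<in> S" "u \<noteq> v" for u v
      using neg that by (meson nat_le_linear)
  qed (use \<open>finite S\<close> in auto)
  also have "card (\<Union>v\<in>S. nbrs v) \<le> card W"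
    by (rule card_mono) (use fin in \<open>auto simp: nbrs_def\<close>)
  finally show False using S W by simp
qed

(* A triangle x, y, z and further neighbours x', y', z' of its vertices would be six vertices whose
   neighbourhoods pairwise meet in few vertices: a large common neighbourhood of two of them
   yields a path that closes up to a cycle of length 2k+1. *)
lemma triangle_free_of_min_degree:
  assumes k: "k \<ge> 1" and cyc: "\<not> has_cycle (2 * k + 1)"
    and ramsey: "\<And>(V :: 'a set) (E :: 'a set set). \<lbrakk>finite V; r \<le> card V\<rbrakk> \<Longrightarrow>
      \<exists>C\<subseteq>V. card C = k \<and> clique C E \<or> card C = 6 \<and> indep C E"
    and deg: "\<And>v. v \<in> W \<Longrightarrow> card W \<le> 5 * card (nbrs v)"
    and W: "180 * (r + 2 * k + 8) < card W"
    and xyz: "x \<in> W" "y \<in> W" "z \<in> W" "R x y" "R x z" "R y z"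
  shows False
proof (cases "k = 1")
  case True
  have "x \<noteq> y" "x \<noteq> z" "y \<noteq> z" using xyz irrefl by auto
  then have "has_cycle 3" unfolding has_cycle_def
    using xyz by (intro exI[of _ "[x, y, z]"]) (auto intro: sym[of x z])
  with True cyc show False by simp
next
  case False
  with k have k2: "k \<ge> 2" by simp
  \<comment> \<open>This is at least \<open>2 * k + 5\<close>, which \<open>linked_path\<close>
    needs for at most three forbidden vertices, and at least \<open>r + 3\<close>, which leaves
    \<open>r\<close> common neighbours for Ramsey's theorem.\<close>
  define L where "L = r + 2 * k + 8"
  define linked where "linked u v \<longleftrightarrow> L \<le> card (nbrs u \<inter> nbrs v)" for u v
  have six: "\<exists>p\<in>S. \<exists>q\<in>S. p \<noteq> q \<and> L \<le> card (nbrs p \<inter> nbrs q)" if "S \<subseteq> W" "card S = 6" for S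
    by (rule six_linked) (use deg that W in \<open>simp_all add: L_def\<close>)
  have linked_sym: "linked u v \<longleftrightarrow> linked v u" for u v
    by (simp add: linked_def Int_commute)
  have path: "\<exists>ps. length ps = 2 * j + 1 \<and> distinct ps \<and> set ps \<subseteq> W - F \<and> successively R ps
      \<and> hd ps = u \<and> last ps = v"
    if "linked u v" "u \<in> W - F" "v \<in> W - F" "u \<noteq> v" "finite F" "card F \<le> 3" "1 \<le> j" "j \<le> k"
    for u v F j
  proof (rule linked_path[where L = "2 * k + 5" and r = r and k = k])
    show "\<exists>p\<in>S. \<exists>q\<in>S. p \<noteq> q \<and> 2 * k + 5 \<le> card (nbrs p \<inter> nbrs q)"
      if S: "S \<subseteq> W" "card S = 6" for S
    proof -
      obtain p q where "p \<in> S" "q \<in> S" "p \<noteq> q" "L \<le> card (nbrs p \<inter> nbrs q)"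
        using six[OF S] unfolding L_def by blast
      then show ?thesis unfolding L_def
        by (intro bexI[of _ p] bexI[of _ q]) auto
    qed
  qed (use that ramsey in \<open>auto simp: linked_def L_def\<close>)
  \<comment> \<open>A path on \<open>2 * k + 1\<close> vertices from \<open>u\<close> to
    \<open>v\<close> would be closed by the edge between them.\<close>
  have not_linked_adj: "\<not> linked u v" if "u \<in> W" "v \<in> W" "R u v" for u v
  proof
    assume "linked u v"
    moreover have "u \<noteq> v" using that(3) irrefl by blast
    ultimately have "\<exists>ps. length ps = 2 * k + 1 \<and> distinct ps \<and> set ps \<subseteq> W - {} \<and> successively R ps
        \<and> hd ps = u \<and> last ps = v"
      by (intro path) (use that k in simp_all)
    then obtain ps where "length ps = 2 * k + 1" "distinct ps" "set ps \<subseteq> W" "successively R ps"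
      "hd ps = u" "last ps = v" by blast
    moreover have "R v u" using that(3) by (rule sym)
    ultimately have "has_cycle (2 * k + 1)"
      unfolding has_cycle_def by (intro exI[of _ ps]) simp
    with cyc show False by blast
  qed
  \<comment> \<open>A path on \<open>2 * k - 1\<close> vertices from \<open>u\<close> to
    \<open>v\<close> avoiding \<open>p\<close> and \<open>q\<close> would be closed by the walk v,
    p, q, u. That path has the form \<open>2 * j + 1\<close> with \<open>j = k - 1\<close>, which is
    positive because \<open>k \<ge> 2\<close>.\<close>
  have not_linked_via: "\<not> linked u v"
    if "u \<in> W - {p, q}" "v \<in> W - {p, q}" "u \<noteq> v" "p \<in> W" "q \<in> W" "R v p" "R p q" "R q u"
    for u v p q
  proof
    assume "linked u v"
    then have "\<exists>ps. length ps = 2 * (k - 1) + 1 \<and> distinct ps \<and> set ps \<subseteq> W - {p, q}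
        \<and> successively R ps \<and> hd ps = u \<and> last ps = v"
      by (rule path) (use that k2 in \<open>simp_all add: card_insert_if\<close>)
    then obtain ps where ps: "length ps = 2 * (k - 1) + 1" "distinct ps" "set ps \<subseteq> W - {p, q}"
      "successively R ps" "hd ps = u" "last ps = v" by blast
    have "p \<noteq> q" using that(7) irrefl by blast
    moreover have "ps \<noteq> []" using ps(1) by auto
    moreover have "p \<notin> set ps" "q \<notin> set ps" "set ps \<subseteq> W" "length ps + 2 = 2 * k + 1"
      using ps(1,3) k2 by auto
    ultimately have "has_cycle (2 * k + 1)"
      unfolding has_cycle_def using that ps(2,4-6)
      by (intro exI[of _ "ps @ [p, q]"]) (simp add: successively_append_iff)
    with cyc show False by blast
  qed
  have pick: "\<exists>w. w \<in> W \<and> R v w \<and> w \<notin> set F" if "v \<in> W" "length F \<le> 4" for v F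
  proof -
    have "card (set F) < card (nbrs v)"
      using deg[OF that(1)] W that(2) card_length[of F] by simp
    then obtain w where "w \<in> nbrs v" "w \<notin> set F"
      by (metis card_mono finite_set leD subsetI)
    then show ?thesis by (auto simp: nbrs_def)
  qed
  obtain x' where x': "x' \<in> W" "R x x'" "x' \<notin> {y, z}"
    using pick[of x "[y, z]"] xyz by auto
  obtain y' where y': "y' \<in> W" "R y y'" "y' \<notin> {x, z, x'}"
    using pick[of y "[x, z, x']"] xyz by auto
  obtain z' where z': "z' \<in> W" "R z z'" "z' \<notin> {x, y, x', y'}"
    using pick[of z "[x, y, x', y']"] xyz by auto
  have ne: "x \<noteq> y" "x \<noteq> z" "y \<noteq> z" "x \<noteq> x'" "y \<noteq> y'" "z \<noteq> z'"
    using xyz x' y' z' irrefl by blast+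
  note R = xyz(4-6) sym[OF xyz(4)] sym[OF xyz(5)] sym[OF xyz(6)] x'(2) y'(2) z'(2)
    sym[OF x'(2)] sym[OF y'(2)] sym[OF z'(2)]
  have "\<not> linked x y" "\<not> linked x z" "\<not> linked y z" "\<not> linked x x'" "\<not> linked y y'" "\<not> linked z z'"
    using not_linked_adj R xyz x' y' z' by blast+
  \<comment> \<open>The two vertices supplied are the interior of the closing walk, here y, z, x,
    x'. The remaining cases follow the same pattern.\<close>
  moreover have "\<not> linked x' y"
    by (rule not_linked_via[of _ z x]) (use R ne xyz x' y' z' in auto)
  moreover have "\<not> linked x' z"
    by (rule not_linked_via[of _ y x]) (use R ne xyz x' y' z' in auto)
  moreover have "\<not> linked y' x"
    by (rule not_linked_via[of _ z y]) (use R ne xyz x' y' z' in auto)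
  moreover have "\<not> linked y' z"
    by (rule not_linked_via[of _ x y]) (use R ne xyz x' y' z' in auto)
  moreover have "\<not> linked z' x"
    by (rule not_linked_via[of _ y z]) (use R ne xyz x' y' z' in auto)
  moreover have "\<not> linked z' y"
    by (rule not_linked_via[of _ x z]) (use R ne xyz x' y' z' in auto)
  moreover have "\<not> linked x' y'"
    by (rule not_linked_via[of _ y x]) (use R ne xyz x' y' z' in auto)
  moreover have "\<not> linked x' z'"
    by (rule not_linked_via[of _ z x]) (use R ne xyz x' y' z' in auto)
  moreover have "\<not> linked y' z'"
    by (rule not_linked_via[of _ z y]) (use R ne xyz x' y' z' in auto)
  ultimately have "\<not> (\<exists>p\<in>{x, y, z, x', y', z'}. \<exists>q\<in>{x, y, z, x', y', z'}. p \<noteq> q \<and> linked p q)"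
    by (simp add: linked_sym[of y x] linked_sym[of z x] linked_sym[of z y] linked_sym[of x x']
        linked_sym[of y x'] linked_sym[of z x'] linked_sym[of x y'] linked_sym[of y y']
        linked_sym[of z y'] linked_sym[of x z'] linked_sym[of y z'] linked_sym[of z z']
        linked_sym[of y' x'] linked_sym[of z' x'] linked_sym[of z' y'])
  moreover have "card {x, y, z, x', y', z'} = 6"
    using ne x' y' z' by auto
  ultimately show False
    using six[of "{x, y, z, x', y', z'}"] xyz x' y' z' unfolding linked_def by blast
qed

end

section \<open>Triangles paid for by degree deviations\<close>

text \<open>If this fails, the quadratic bound on the number of triangles leaves only boundedly many
  vertices of atypical degree. Since every triangle meets one of these, there are only linearly many
  triangles per atypical vertex, whereas each such vertex contributes a quadratic deviation. The
  factor 3/2 is the cost of a triangle in \<open>card_edges_le_of_links\<close>.\<close>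

lemma three_halves_triangles_le:
  fixes k :: nat
  assumes k: "k \<ge> 1"
  shows "\<exists>n0. \<forall>n\<ge>n0. \<forall>(W :: 'a set) R. finite_graph W R \<longrightarrow> card W + 2 = n \<longrightarrow>
    \<not> finite_graph.has_cycle W R (2 * k + 1) \<longrightarrow>
    3 / 2 * (\<Sum>x\<in>W. real (card (finite_graph.triangles_at W R x)))
      \<le> (\<Sum>x\<in>W. (real (card (finite_graph.nbrs W R x)) - n / 4)\<^sup>2)"
proof -
  obtain r where ramsey: "\<And>(V :: 'a set) (E :: 'a set set). \<lbrakk>finite V; r \<le> card V\<rbrakk> \<Longrightarrow>
      \<exists>C\<subseteq>V. card C = k \<and> clique C E \<or> card C = 6 \<and> indep C E"
    using ramsey2[of k 6] by metis
  \<comment> \<open>The term \<open>2000000 * k\<close> dominates the fewer than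
    \<open>60000 * k\<close> deleted vertices in the degree estimate and the final threshold
    \<open>180000 * k\<close>.\<close>
  define n0 where "n0 = 180 * (r + 2 * k + 8) + 2000000 * k + 3"
  have "3 / 2 * (\<Sum>x\<in>W. real (card (finite_graph.triangles_at W R x)))
      \<le> (\<Sum>x\<in>W. (real (card (finite_graph.nbrs W R x)) - n / 4)\<^sup>2)"
    if n: "n \<ge> n0" and G: "finite_graph W R" and W: "card W + 2 = n"
      and cyc: "\<not> finite_graph.has_cycle W R (2 * k + 1)"
    for n :: nat and W :: "'a set" and R
  proof (rule ccontr)
    interpret finite_graph W R by (fact G)
    define dev where "dev x = (real (card (nbrs x)) - n / 4)\<^sup>2" for x
    define \<tau> where "\<tau> = (\<Sum>x\<in>W. real (card (triangles_at x)))"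
    assume "\<not> ?thesis"
    then have less: "(\<Sum>x\<in>W. dev x) < 3 / 2 * \<tau>"
      by (simp add: dev_def \<tau>_def)
    have tri: "real (card (triangles_at x)) \<le> 4 * k * n" if "x \<in> W" for x
    proof -
      have "card (triangles_at x) \<le> 4 * k * card W"
        by (rule card_triangles_at_le[OF k that cyc])
      also have "\<dots> \<le> 4 * k * n" using W by simp
      finally show ?thesis by (metis of_nat_le_iff of_nat_mult of_nat_numeral)
    qed
    define B where "B = {x \<in> W. real n / 100 \<le> \<bar>real (card (nbrs x)) - n / 4\<bar>}"
    have B: "B \<subseteq> W" "finite B" using fin by (auto simp: B_def)
    have "card B * (real n / 100)\<^sup>2 = (\<Sum>x\<in>B. (real n / 100)\<^sup>2)" by simp
    also have "\<dots> \<le> (\<Sum>x\<in>B. dev x)"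
    proof (rule sum_mono)
      fix x assume "x \<in> B"
      then have "real n / 100 \<le> \<bar>real (card (nbrs x)) - n / 4\<bar>" by (simp add: B_def)
      then have "(real n / 100)\<^sup>2 \<le> \<bar>real (card (nbrs x)) - n / 4\<bar>\<^sup>2" by (rule power_mono) simp
      then show "(real n / 100)\<^sup>2 \<le> dev x" by (simp add: dev_def)
    qed
    also have "\<dots> \<le> (\<Sum>x\<in>W. dev x)"
      by (rule sum_mono2) (use B fin in \<open>auto simp: dev_def\<close>)
    finally have B_less: "card B * (real n / 100)\<^sup>2 < 3 / 2 * \<tau>" using less by linarith

    \<comment> \<open>First a crude bound: at most \<open>4 * k * n\<close> pairs at each vertex. It
      is used only to bound \<open>card B\<close>.\<close>
    have "\<tau> \<le> (\<Sum>x\<in>W. real (4 * k * n))"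
      unfolding \<tau>_def by (rule sum_mono) (use tri in simp)
    also have "\<dots> = real (card W) * real (4 * k * n)" by simp
    also have "\<dots> \<le> real n * real (4 * k * n)"
      by (rule mult_right_mono) (use W in auto)
    finally have "\<tau> \<le> real n * real (4 * k * n)" .
    then have "card B * (real n / 100)\<^sup>2 < 6 * k * (real n)\<^sup>2"
      using B_less by (simp add: power2_eq_square mult_ac)
    then have "card B / 10000 * (real n)\<^sup>2 < 6 * k * (real n)\<^sup>2"
      by (simp add: power_divide)
    then have "card B / 10000 < real (6 * k)"
      by (rule mult_right_less_imp_less) simp
    then have card_B: "card B < 60000 * k" by simp

    let ?W = "W - B"
    interpret H: finite_graph ?W R
      by unfold_locales (use fin sym irrefl in auto)
    have card_W: "card ?W = card W - card B" using B by (simp add: card_Diff_subset)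
    have no_triangle: False if "x \<in> ?W" "y \<in> ?W" "z \<in> ?W" "R x y" "R x z" "R y z" for x y z
    proof (rule H.triangle_free_of_min_degree[OF k _ ramsey _ _ that])
      show "\<not> H.has_cycle (2 * k + 1)"
        using cyc unfolding H.has_cycle_def has_cycle_def by blast
      show "180 * (r + 2 * k + 8) < card ?W"
        using card_W card_B n W unfolding n0_def by linarith
      show "card ?W \<le> 5 * card (H.nbrs v)" if v: "v \<in> ?W" for v
      proof -
        have "card (nbrs v) - card B \<le> card (nbrs v - B)"
          by (rule diff_card_le_card_Diff) (use B in auto)
        also have "nbrs v - B = H.nbrs v" by (auto simp: nbrs_def H.nbrs_def)
        finally have "card (nbrs v) - card B \<le> card (H.nbrs v)" .
        moreover have "\<bar>real (card (nbrs v)) - n / 4\<bar> < real n / 100" using v by (auto simp: B_def)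
        \<comment> \<open>Outside \<open>B\<close> the degree is above (1/4 - 1/100) n = 6n/25, and
          deleting the few vertices of \<open>B\<close> keeps it above a fifth of the order.\<close>
        then have "25 * card (nbrs v) \<ge> 6 * n" by linarith
        moreover have "2000000 * k \<le> n" using n by (simp add: n0_def)
        ultimately show ?thesis using card_B card_W W by linarith
      qed
    qed

    \<comment> \<open>Ordered triangles with \<open>b\<close> in first, second or third
      position.\<close>
    let ?T = "\<lambda>b. (\<lambda>(p, q). (b, p, q)) ` triangles_at b \<union> (\<lambda>(p, q). (p, b, q)) ` triangles_at b
      \<union> (\<lambda>(p, q). (p, q, b)) ` triangles_at b"
    have fin_tri: "finite (triangles_at x)" for x
      by (rule finite_subset[of _ "W \<times> W"]) (use fin in \<open>auto simp: triangles_at_def\<close>)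
    have "(SIGMA x:W. triangles_at x) \<subseteq> (\<Union>b\<in>B. ?T b)"
    proof clarify
      fix x y z assume x: "x \<in> W" and yz: "(y, z) \<in> triangles_at x"
      then have t: "y \<in> W" "z \<in> W" "R x y" "R x z" "R y z" by (auto simp: triangles_at_def)
      then have tri: "(x, z) \<in> triangles_at y" "(x, y) \<in> triangles_at z"
        using x sym by (auto simp: triangles_at_def)
      from no_triangle[of x y z] x t consider "x \<in> B" | "y \<in> B" | "z \<in> B" by blast
      then show "(x, y, z) \<in> (\<Union>b\<in>B. ?T b)"
        by cases (use yz tri in force)+
    qed
    then have "card (SIGMA x:W. triangles_at x) \<le> card (\<Union>b\<in>B. ?T b)"
      by (rule card_mono[rotated]) (use B fin_tri in auto)
    also have "\<dots> \<le> (\<Sum>b\<in>B. card (?T b))"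
      by (rule card_UN_le) (use B in auto)
    also have "\<dots> \<le> (\<Sum>b\<in>B. 3 * card (triangles_at b))"
    proof (rule sum_mono)
      fix b
      have "card (?T b) \<le> card ((\<lambda>(p, q). (b, p, q)) ` triangles_at b)
          + card ((\<lambda>(p, q). (p, b, q)) ` triangles_at b) + card ((\<lambda>(p, q). (p, q, b)) ` triangles_at b)"
        by (meson add_le_mono1 card_Un_le le_trans)
      also have "\<dots> \<le> 3 * card (triangles_at b)"
        using card_image_le[OF fin_tri[of b], of "\<lambda>(p, q). (b, p, q)"]
          card_image_le[OF fin_tri[of b], of "\<lambda>(p, q). (p, b, q)"]
          card_image_le[OF fin_tri[of b], of "\<lambda>(p, q). (p, q, b)"] by linarith
      finally show "card (?T b) \<le> 3 * card (triangles_at b)" .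
    qed
    finally have "card (SIGMA x:W. triangles_at x) \<le> (\<Sum>b\<in>B. 3 * card (triangles_at b))" .
    moreover have "\<tau> = card (SIGMA x:W. triangles_at x)"
      using fin fin_tri by (simp add: \<tau>_def)
    ultimately have "\<tau> \<le> real (\<Sum>b\<in>B. 3 * card (triangles_at b))"
      by (metis of_nat_le_iff)
    also have "\<dots> = (\<Sum>b\<in>B. 3 * real (card (triangles_at b)))" by simp
    also have "\<dots> \<le> (\<Sum>b\<in>B. 3 * real (4 * k * n))"
    proof (rule sum_mono)
      fix b assume "b \<in> B"
      then have "b \<in> W" using B by blast
      then show "3 * real (card (triangles_at b)) \<le> 3 * real (4 * k * n)"
        using tri by (intro mult_left_mono) simp_all
    qed
    also have "\<dots> = card B * (12 * real k * n)" by simp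
    \<comment> \<open>The constant 18 is 3/2 times 12. Strictness excludes
      \<open>card B = 0\<close>, so the factor cancels.\<close>
    finally have "card B * (real n / 100)\<^sup>2 < card B * (18 * real k * n)" using B_less by simp
    then have "(real n / 100)\<^sup>2 < 18 * real k * n"
      by (rule mult_left_less_imp_less) simp
    then have "real n * n < real n * (180000 * k)"
      by (simp add: power2_eq_square field_simps)
    then have "real n < real (180000 * k)"
      by (rule mult_left_less_imp_less) simp
    then show False using n unfolding n0_def by linarith
  qed
  then show ?thesis by blast
qed

subsection \<open>Counting over quadruples\<close>

text \<open>Each edge has 4! = 24 orderings, and a tuple with a repetition spans fewer than four
  vertices, so it never gives an edge. The orderings are counted as distinct lists.\<close>

lemma sum_of_bool_insert4:
  fixes V :: "'a set"
  assumes "finite V" "E \<subseteq> [V]\<^bsup>4\<^esup>"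
  shows "(\<Sum>a\<in>V. \<Sum>b\<in>V. \<Sum>c\<in>V. \<Sum>d\<in>V. of_bool ({a, b, c, d} \<in> E)) = 24 * real (card E)"
proof -
  have E: "finite E" "\<And>X. X \<in> E \<Longrightarrow> finite X \<and> card X = 4 \<and> X \<subseteq> V"
    using assms finite_imp_finite_nsets[of V 4] by (auto simp: nsets_def intro: finite_subset)
  let ?lists = "\<lambda>X :: 'a set. {xs. length xs = 4 \<and> distinct xs \<and> set xs \<subseteq> X}"
  let ?tuples = "{(a, b, c, d) \<in> V \<times> V \<times> V \<times> V. {a, b, c, d} \<in> E}"
  have fin_lists: "finite (?lists X)" if "X \<in> E" for X
    by (rule finite_subset[OF _ finite_lists_length_eq[of X 4]]) (use E that in auto)
  have card_lists: "card (?lists X) = 24" if "X \<in> E" for X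
  proof -
    have "{1..4 :: nat} = {1, 2, 3, 4}" by auto
    then show ?thesis
      using card_lists_distinct_length_eq[of X 4] E(2)[OF that] by simp
  qed
  have set_eq: "set xs = X" if "X \<in> E" "xs \<in> ?lists X" for X xs
    using that E(2)[OF that(1)] by (intro card_subset_eq) (auto simp: distinct_card)
  have "inj_on (\<lambda>(a, b, c, d). [a, b, c, d]) ?tuples"
    by (auto simp: inj_on_def)
  moreover have "(\<lambda>(a, b, c, d). [a, b, c, d]) ` ?tuples = (\<Union>X\<in>E. ?lists X)"
  proof (intro equalityI subsetI)
    fix xs assume "xs \<in> (\<lambda>(a, b, c, d). [a, b, c, d]) ` ?tuples"
    then obtain a b c d where xs: "xs = [a, b, c, d]" "{a, b, c, d} \<in> E" by auto
    then have "card (set xs) = length xs" using E(2) by fastforce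
    then have "distinct xs" by (rule card_distinct)
    then have "xs \<in> ?lists {a, b, c, d}" using xs(1) by simp
    with xs(2) show "xs \<in> (\<Union>X\<in>E. ?lists X)" by (rule UN_I)
  next
    fix xs assume "xs \<in> (\<Union>X\<in>E. ?lists X)"
    then obtain X where X: "X \<in> E" "xs \<in> ?lists X" by blast
    then obtain a b c d where "xs = [a, b, c, d]"
      by (auto simp: length_Suc_conv numeral_eq_Suc)
    with set_eq[OF X] X(1) E(2) show "xs \<in> (\<lambda>(a, b, c, d). [a, b, c, d]) ` ?tuples"
      by (intro image_eqI[of _ _ "(a, b, c, d)"]) auto
  qed
  ultimately have "card ?tuples = card (\<Union>X\<in>E. ?lists X)"
    using card_image by fastforce
  also have "\<dots> = (\<Sum>X\<in>E. card (?lists X))"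
    by (rule card_UN_disjoint) (use E(1) fin_lists set_eq in blast)+
  also have "\<dots> = 24 * card E"
    using card_lists by simp
  finally have "card ?tuples = 24 * card E" .
  moreover have "(\<Sum>a\<in>V. \<Sum>b\<in>V. \<Sum>c\<in>V. \<Sum>d\<in>V. of_bool ({a, b, c, d} \<in> E)) =
      (\<Sum>(a, b, c, d)\<in>V \<times> V \<times> V \<times> V. of_bool ({a, b, c, d} \<in> E) :: real)"
    by (simp add: sum.cartesian_product case_prod_unfold)
  moreover have "\<dots> = (\<Sum>t\<in>V \<times> V \<times> V \<times> V. of_bool (t \<in> ?tuples))"
    by (rule sum.cong) auto
  moreover have "\<dots> = card ?tuples"
  proof -
    have "(V \<times> V \<times> V \<times> V) \<inter> {t. t \<in> ?tuples} = ?tuples" by auto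
    then show ?thesis using assms(1) by (simp only: sum_of_bool_eq finite_cartesian_product)
  qed
  ultimately show ?thesis by simp
qed

text \<open>Passes between distinct triples, where links make sense, and all triples, where
  summation variables can be permuted freely.\<close>

lemma sum_distinct3:
  fixes f :: "'a \<Rightarrow> 'a \<Rightarrow> 'a \<Rightarrow> 'b :: comm_monoid_add"
  assumes "finite V" and zero: "\<And>a b c. a = b \<or> c = a \<or> c = b \<Longrightarrow> f a b c = 0"
  shows "(\<Sum>a\<in>V. \<Sum>b\<in>V - {a}. \<Sum>c\<in>V - {a, b}. f a b c) = (\<Sum>a\<in>V. \<Sum>b\<in>V. \<Sum>c\<in>V. f a b c)"
proof (rule sum.cong[OF refl])
  fix a
  have "(\<Sum>b\<in>V - {a}. \<Sum>c\<in>V - {a, b}. f a b c) = (\<Sum>b\<in>V - {a}. \<Sum>c\<in>V. f a b c)"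
    by (intro sum.cong sum.mono_neutral_left) (use assms in auto)
  also have "\<dots> = (\<Sum>b\<in>V. \<Sum>c\<in>V. f a b c)"
    by (intro sum.mono_neutral_left) (use assms in auto)
  finally show "(\<Sum>b\<in>V - {a}. \<Sum>c\<in>V - {a, b}. f a b c) = (\<Sum>b\<in>V. \<Sum>c\<in>V. f a b c)" .
qed

lemma real_choose_3: "real (n choose 3) = real n * (real n - 1) * (real n - 2) / 6"
proof -
  have two: "real (m choose 2) = real m * (real m - 1) / 2" for m
    by (induction m) (simp_all add: numeral_2_eq_2 field_simps)
  show ?thesis
  proof (induction n)
    case (Suc n)
    have "Suc n choose 3 = (n choose 2) + (n choose 3)"
      by (simp add: numeral_3_eq_3 numeral_2_eq_2)
    then show ?case by (simp add: Suc two field_simps)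
  qed simp
qed

lemma sum_distinct3_const:
  assumes "finite V"
  shows "(\<Sum>a\<in>V. \<Sum>b\<in>V - {a}. \<Sum>c\<in>V - {a, b}. x) = 6 * real (card V choose 3) * x"
\<comment> \<open>Natural-number subtraction in \<open>card V - 2\<close> truncates here, so these
  orders are treated separately.\<close>
proof (cases "card V < 2")
  case True
  then have "card V = 0 \<or> card V = 1" by auto
  then show ?thesis using assms by (auto simp: card_1_singleton_iff real_choose_3)
next
  case False
  have "(\<Sum>a\<in>V. \<Sum>b\<in>V - {a}. \<Sum>c\<in>V - {a, b}. x)
      = (\<Sum>a\<in>V. \<Sum>b\<in>V - {a}. (real (card V) - 2) * x)"
    by (intro sum.cong refl) (use False assms in \<open>auto simp: card_Diff_subset of_nat_diff\<close>)
  also have "\<dots> = (\<Sum>a\<in>V. (real (card V) - 1) * ((real (card V) - 2) * x))"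
    by (intro sum.cong refl) (use False assms in \<open>auto simp: of_nat_diff\<close>)
  also have "\<dots> = 6 * real (card V choose 3) * x"
    by (simp add: real_choose_3)
  finally show ?thesis .
qed

section \<open>Squared codegrees and triangles in links\<close>

text \<open>Packaged as one operator so that each exchange of adjacent summation variables is a
  single rewrite.\<close>

definition sum5 :: "'a set \<Rightarrow> ('a \<Rightarrow> 'a \<Rightarrow> 'a \<Rightarrow> 'a \<Rightarrow> 'a \<Rightarrow> real) \<Rightarrow> real" where
  "sum5 V f = (\<Sum>a\<in>V. \<Sum>b\<in>V. \<Sum>c\<in>V. \<Sum>d\<in>V. \<Sum>z\<in>V. f a b c d z)"

lemma sum5_swap12: "sum5 V (\<lambda>a b c d z. f b a c d z) = sum5 V f"
  unfolding sum5_def by (rule sum.swap)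

lemma sum5_swap23: "sum5 V (\<lambda>a b c d z. f a c b d z) = sum5 V f"
  unfolding sum5_def by (rule sum.cong[OF refl], rule sum.swap)

lemma sum5_swap34: "sum5 V (\<lambda>a b c d z. f a b d c z) = sum5 V f"
  unfolding sum5_def by (rule sum.cong[OF refl], rule sum.cong[OF refl], rule sum.swap)

text \<open>If m of the four indicators hold, the claim is m \<le> 1 + (m choose 2).\<close>

lemma sum_le_one_plus_products:
  fixes x y z w :: bool and h :: real
  assumes "0 \<le> h"
  shows "h * of_bool x + h * of_bool y + h * of_bool z + h * of_bool w \<le> h
    + (h * of_bool x * of_bool y + h * of_bool x * of_bool z + h * of_bool x * of_bool w
    + h * of_bool y * of_bool z + h * of_bool y * of_bool w + h * of_bool z * of_bool w)"
  using assms by (cases x; cases y; cases z; cases w) simp_all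

text \<open>For an edge abcd and a vertex z, let m count the triples of the edge that z extends to
  an edge, and apply m \<le> 1 + (m choose 2). By symmetry each of the four triples contributes the
  sum of squared codegrees. Two such triples share a pair, and the other two vertices form a
  triangle with z in the link of that pair; this gives six equal triangle sums.\<close>

lemma four_mult_sum_codegree_square_le:
  fixes V :: "'a set" and h :: "'a \<Rightarrow> 'a \<Rightarrow> 'a \<Rightarrow> 'a \<Rightarrow> real"
  assumes h_def: "\<And>a b c d. h a b c d = of_bool ({a, b, c, d} \<in> E)"
  shows "4 * (\<Sum>a\<in>V. \<Sum>b\<in>V. \<Sum>c\<in>V. (\<Sum>d\<in>V. h a b c d)\<^sup>2)
    \<le> card V * (\<Sum>a\<in>V. \<Sum>b\<in>V. \<Sum>c\<in>V. \<Sum>d\<in>V. h a b c d)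
      + 6 * (\<Sum>a\<in>V. \<Sum>b\<in>V. \<Sum>c\<in>V. \<Sum>d\<in>V. \<Sum>z\<in>V. h a b c d * h a b c z * h a b d z)"
proof -
  have h: "h b a c d = h a b c d" "h a c b d = h a b c d" "h a b d c = h a b c d" for a b c d
    by (simp_all add: h_def insert_commute)
  define S where "S = sum5 V (\<lambda>a b c d z. h a b c d * h a b c z)"
  have S2: "sum5 V (\<lambda>a b c d z. h a b c d * h a b d z) = S"
    unfolding S_def by (subst sum5_swap34[symmetric]) (simp only: h)
  have S3: "sum5 V (\<lambda>a b c d z. h a b c d * h a c d z) = S"
    unfolding S2[symmetric] by (subst sum5_swap23[symmetric]) (simp only: h)
  have S4: "sum5 V (\<lambda>a b c d z. h a b c d * h b c d z) = S"
    unfolding S3[symmetric] by (subst sum5_swap12[symmetric]) (simp only: h)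
  define T where "T = sum5 V (\<lambda>a b c d z. h a b c d * h a b c z * h a b d z)"
  have T13: "sum5 V (\<lambda>a b c d z. h a b c d * h a b c z * h a c d z) = T"
    unfolding T_def by (subst sum5_swap23[symmetric]) (simp only: h)
  have T23: "sum5 V (\<lambda>a b c d z. h a b c d * h a b d z * h a c d z) = T"
    unfolding T13[symmetric] by (subst sum5_swap34[symmetric]) (simp only: h)
  have T14: "sum5 V (\<lambda>a b c d z. h a b c d * h a b c z * h b c d z) = T"
    unfolding T13[symmetric] by (subst sum5_swap12[symmetric]) (simp only: h)
  have T24: "sum5 V (\<lambda>a b c d z. h a b c d * h a b d z * h b c d z) = T"
    unfolding T23[symmetric] by (subst sum5_swap12[symmetric]) (simp only: h)
  have T34: "sum5 V (\<lambda>a b c d z. h a b c d * h a c d z * h b c d z) = T"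
    unfolding T24[symmetric] by (subst sum5_swap23[symmetric]) (simp only: h)
  have "(\<Sum>a\<in>V. \<Sum>b\<in>V. \<Sum>c\<in>V. (\<Sum>d\<in>V. h a b c d)\<^sup>2) = S"
    by (simp add: S_def sum5_def power2_eq_square sum_product)
  moreover have "S + S + S + S = sum5 V (\<lambda>a b c d z. h a b c d * h a b c z + h a b c d * h a b d z
      + h a b c d * h a c d z + h a b c d * h b c d z)"
    unfolding sum5_def sum.distrib
    by (fold sum5_def) (simp only: S_def[symmetric] S2 S3 S4)
  moreover have "\<dots> \<le> sum5 V (\<lambda>a b c d z. h a b c d
      + (h a b c d * h a b c z * h a b d z + h a b c d * h a b c z * h a c d z
      + h a b c d * h a b c z * h b c d z + h a b c d * h a b d z * h a c d z
      + h a b c d * h a b d z * h b c d z + h a b c d * h a c d z * h b c d z))"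
    unfolding sum5_def h_def by (intro sum_mono sum_le_one_plus_products) simp
  moreover have "\<dots> = sum5 V (\<lambda>a b c d z. h a b c d) + (T + T + T + T + T + T)"
    unfolding sum5_def sum.distrib
    by (fold sum5_def) (simp only: T_def[symmetric] T13 T14 T23 T24 T34)
  moreover have "sum5 V (\<lambda>a b c d z. h a b c d) = card V * (\<Sum>a\<in>V. \<Sum>b\<in>V. \<Sum>c\<in>V. \<Sum>d\<in>V. h a b c d)"
    by (simp add: sum5_def sum_distrib_left)
  ultimately show ?thesis by (simp add: T_def sum5_def)
qed

abbreviation link :: "'a set set \<Rightarrow> 'a \<Rightarrow> 'a \<Rightarrow> 'a \<Rightarrow> 'a \<Rightarrow> bool" where
  "link E a b \<equiv> \<lambda>c d. {a, b, c, d} \<in> E"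

lemma nsets_4_distinct: "{a, b, c, d} \<in> [V]\<^bsup>4\<^esup> \<longleftrightarrow> distinct [a, b, c, d] \<and> {a, b, c, d} \<subseteq> V"
proof -
  have "card (set [a, b, c, d]) = length [a, b, c, d] \<longleftrightarrow> distinct [a, b, c, d]"
    using card_distinct distinct_card by blast
  then have "card {a, b, c, d} = 4 \<longleftrightarrow> distinct [a, b, c, d]"
    by (simp add: numeral_eq_Suc)
  then show ?thesis unfolding nsets_def by blast
qed

lemma finite_graph_link:
  assumes "finite V" "E \<subseteq> [V]\<^bsup>4\<^esup>"
  shows "finite_graph (V - {a, b}) (link E a b)"
proof
  show "{a, b, y, x} \<in> E" if "{a, b, x, y} \<in> E" for x y
    using that by (simp add: insert_commute)
  show "{a, b, x, x} \<notin> E" for x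
  proof
    assume "{a, b, x, x} \<in> E"
    then have "{a, b, x, x} \<in> [V]\<^bsup>4\<^esup>" using assms(2) by blast
    then show False by (simp only: nsets_4_distinct) simp
  qed
qed (use assms in simp)

text \<open>The link inequalities, summed over ordered pairs, bound the triangle sum
  \<open>T\<close> by the Cauchy-Schwarz defect. Together with the codegree inequality this
  eliminates both \<open>S\<close> and \<open>T\<close>.\<close>

lemma card_edges_le_of_links:
  fixes V :: "'a set"
  assumes V: "finite V" and E: "E \<subseteq> [V]\<^bsup>4\<^esup>"
    and links: "\<And>a b. \<lbrakk>a \<in> V; b \<in> V; a \<noteq> b\<rbrakk> \<Longrightarrow>
      3 / 2 * (\<Sum>x\<in>V - {a, b}. real (card (finite_graph.triangles_at (V - {a, b}) (link E a b) x)))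
      \<le> (\<Sum>x\<in>V - {a, b}. (real (card (finite_graph.nbrs (V - {a, b}) (link E a b) x)) - card V / 4)\<^sup>2)"
  shows "real (card E) \<le> card V / 16 * real (card V choose 3)"
proof (cases "card V = 0")
  case True
  then show ?thesis using V E by (simp add: nsets_empty_iff)
next
  case False
  define n where "n = real (card V)"
  have n_pos: "n > 0" using False by (simp add: n_def)
  define e where "e = real (card E)"
  define h where "h a b c d = (of_bool ({a, b, c, d} \<in> E) :: real)" for a b c d
  define deg where "deg a b c = (\<Sum>d\<in>V. h a b c d)" for a b c
  define tri where "tri a b c = (\<Sum>d\<in>V. \<Sum>z\<in>V. h a b c d * h a b c z * h a b d z)" for a b c
  have edge: "distinct [a, b, c, d] \<and> {a, b, c, d} \<subseteq> V" if "{a, b, c, d} \<in> E" for a b c d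
    using subsetD[OF E that] by (simp only: nsets_4_distinct)
  have h0: "h a b c d = 0" if "\<not> distinct [a, b, c, d]" for a b c d
    using edge[of a b c d] that by (auto simp: h_def)
  have zero: "deg a b c = 0" "tri a b c = 0" if "a = b \<or> c = a \<or> c = b" for a b c
    using h0 that by (auto simp: deg_def tri_def)
  have links': "3 / 2 * (\<Sum>x\<in>V - {a, b}. tri a b x)
      \<le> (\<Sum>x\<in>V - {a, b}. (deg a b x)\<^sup>2 - n / 2 * deg a b x + n\<^sup>2 / 16)"
    if ab: "a \<in> V" "b \<in> V - {a}" for a b
  proof -
    let ?W = "V - {a, b}"
    interpret L: finite_graph ?W "link E a b"
      by (rule finite_graph_link) fact+
    have "card (L.nbrs x) = deg a b x" for x
    proof -
      have "L.nbrs x = V \<inter> {d. {a, b, x, d} \<in> E}" using edge by (fastforce simp: L.nbrs_def)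
      then show ?thesis using V by (simp add: deg_def h_def sum_of_bool_eq)
    qed
    moreover have "card (L.triangles_at x) = tri a b x" for x
    proof -
      let ?P = "\<lambda>t. {a, b, x, fst t} \<in> E \<and> {a, b, x, snd t} \<in> E \<and> {a, b, fst t, snd t} \<in> E"
      have "tri a b x = (\<Sum>t\<in>V \<times> V. h a b x (fst t) * h a b x (snd t) * h a b (fst t) (snd t))"
        by (simp add: tri_def sum.cartesian_product case_prod_unfold)
      also have "\<dots> = (\<Sum>t\<in>V \<times> V. of_bool (?P t))"
        by (rule sum.cong) (auto simp: h_def)
      also have "\<dots> = card ((V \<times> V) \<inter> {t. ?P t})"
        using V by (simp add: sum_of_bool_eq)
      also have "(V \<times> V) \<inter> {t. ?P t} = L.triangles_at x"
        using edge by (fastforce simp: L.triangles_at_def)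
      finally show ?thesis by simp
    qed
    moreover have "(deg a b x - n / 4)\<^sup>2 = (deg a b x)\<^sup>2 - n / 2 * deg a b x + n\<^sup>2 / 16" for x
      by (simp add: power2_eq_square field_simps)
    moreover have "b \<in> V" "a \<noteq> b" using ab(2) by auto
    ultimately show ?thesis using links[OF ab(1), of b] by (simp add: n_def)
  qed
  define S where "S = (\<Sum>a\<in>V. \<Sum>b\<in>V. \<Sum>c\<in>V. (deg a b c)\<^sup>2)"
  define T where "T = (\<Sum>a\<in>V. \<Sum>b\<in>V. \<Sum>c\<in>V. tri a b c)"
  have e: "(\<Sum>a\<in>V. \<Sum>b\<in>V. \<Sum>c\<in>V. deg a b c) = 24 * e"
    unfolding deg_def h_def e_def by (rule sum_of_bool_insert4[OF V E])
  have "3 / 2 * T = (\<Sum>a\<in>V. \<Sum>b\<in>V - {a}. 3 / 2 * (\<Sum>c\<in>V - {a, b}. tri a b c))"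
    unfolding T_def sum_distrib_left[symmetric] using V zero(2) by (subst sum_distinct3) auto
  also have "\<dots> \<le> (\<Sum>a\<in>V. \<Sum>b\<in>V - {a}. \<Sum>c\<in>V - {a, b}. (deg a b c)\<^sup>2 - n / 2 * deg a b c + n\<^sup>2 / 16)"
    by (intro sum_mono links')
  \<comment> \<open>The constant does not vanish at repeated vertices, so it is split off before the
    sum is extended to all triples.\<close>
  also have "\<dots> = (\<Sum>a\<in>V. \<Sum>b\<in>V - {a}. \<Sum>c\<in>V - {a, b}. (deg a b c)\<^sup>2 - n / 2 * deg a b c)
      + 6 * real (card V choose 3) * (n\<^sup>2 / 16)"
    using sum_distinct3_const[OF V, of "n\<^sup>2 / 16"] by (simp only: sum.distrib)
  also have "(\<Sum>a\<in>V. \<Sum>b\<in>V - {a}. \<Sum>c\<in>V - {a, b}. (deg a b c)\<^sup>2 - n / 2 * deg a b c)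
      = (\<Sum>a\<in>V. \<Sum>b\<in>V. \<Sum>c\<in>V. (deg a b c)\<^sup>2 - n / 2 * deg a b c)"
    by (rule sum_distinct3[OF V]) (simp add: zero)
  also have "\<dots> = S - n / 2 * (24 * e)"
    by (simp only: sum_subtractf sum_distrib_left[symmetric] e S_def)
  finally have 1: "3 / 2 * T \<le> S - 12 * (n * e) + 6 * real (card V choose 3) * (n\<^sup>2 / 16)"
    by (simp add: mult_ac)
  have 2: "4 * S \<le> n * (24 * e) + 6 * T"
    using four_mult_sum_codegree_square_le[of h E V, OF h_def]
    unfolding S_def T_def tri_def e[symmetric] deg_def n_def .
  \<comment> \<open>Four times the first inequality plus the second: \<open>4 * S\<close> and
    \<open>6 * T\<close> cancel exactly, which fixes the factor 3/2.\<close>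
  have "24 * (n * e) \<le> 24 * real (card V choose 3) * (n\<^sup>2 / 16)" using 1 2 by argo
  then have "n * e \<le> n * (n / 16 * real (card V choose 3))"
    by (simp add: power2_eq_square mult_ac)
  then show ?thesis using n_pos by (simp add: n_def e_def)
qed

text \<open>A cycle in the link of \<open>a\<close> and \<open>b\<close>, with these two as the
  suspension vertices, would be a copy of the forbidden hypergraph.\<close>

lemma link_no_cycle:
  fixes V :: "'a set"
  assumes H: "E \<subseteq> [V]\<^bsup>4\<^esup>" and free: "\<not> contains_copy (V, E) (suspension 4 (cycle_graph m))"
    and m: "m \<ge> 1" and ab: "a \<in> V" "b \<in> V" "a \<noteq> b" and V: "finite V"
  shows "\<not> finite_graph.has_cycle (V - {a, b}) (link E a b) m"
proof
  interpret L: finite_graph "V - {a, b}" "link E a b"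
    by (rule finite_graph_link) fact+
  assume "L.has_cycle m"
  then obtain xs where xs: "length xs = m" "distinct xs" "set xs \<subseteq> V - {a, b}"
    "successively (link E a b) xs" "link E a b (last xs) (hd xs)"
    unfolding L.has_cycle_def by blast
  define f :: "nat + nat \<Rightarrow> 'a" where "f = case_sum (\<lambda>i. xs ! i) (\<lambda>j. if j = 0 then a else b)"
  have two: "{..<2 :: nat} = {0, 1}" by auto
  have xs_V: "xs ! i \<in> V - {a, b}" if "i < m" for i
    using xs(1,3) that nth_mem by blast
  have "inj_on f (verts (suspension 4 (cycle_graph m)))"
  proof -
    have "a \<notin> set xs" "b \<notin> set xs" using xs(3) by auto
    then show ?thesis
      using xs(1,2) ab(3)
      by (auto simp: inj_on_def suspension_def cycle_graph_def f_def two nth_eq_iff_index_eq)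
  qed
  moreover have "f ` verts (suspension 4 (cycle_graph m)) \<subseteq> V"
    using ab xs_V by (auto simp: suspension_def cycle_graph_def f_def)
  moreover have "f ` s \<in> E" if s: "s \<in> edges (suspension 4 (cycle_graph m))" for s
  proof -
    obtain i where i: "i < m" "s = {i, (i + 1) mod m} <+> {..<2}"
      using s by (auto simp: suspension_def cycle_graph_def)
    have "link E a b (xs ! i) (xs ! ((i + 1) mod m))"
    proof (cases "i + 1 < m")
      case True
      then show ?thesis
        using successively_nth[OF xs(4), of i] xs(1) by simp
    next
      \<comment> \<open>The closing edge of the cycle: \<open>i + 1\<close> wraps around to
        0.\<close>
      case False
      with i have "i = m - 1" by simp
      moreover have "xs \<noteq> []" using xs(1) m by auto
      ultimately show ?thesis
        using xs(1,5) m by (simp add: last_conv_nth hd_conv_nth)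
    qed
    moreover have "f ` s = {a, b, xs ! i, xs ! ((i + 1) mod m)}"
      by (auto simp: i(2) f_def two Plus_def image_Un)
    ultimately show ?thesis by simp
  qed
  ultimately have "contains_copy (V, E) (suspension 4 (cycle_graph m))"
    unfolding contains_copy_def by auto
  with free show False by blast
qed

subsection \<open>Skew conference matrices\<close>

text \<open>The case \<open>i = j\<close> of skewness forces a zero diagonal. Nothing is required of
  entries outside the first \<open>n\<close> rows and columns.\<close>

definition skew_conference :: "nat \<Rightarrow> (nat \<Rightarrow> nat \<Rightarrow> int) \<Rightarrow> bool" where
  "skew_conference n s \<longleftrightarrow>
     (\<forall>i<n. \<forall>j<n. s j i = - s i j \<and> (i \<noteq> j \<longrightarrow> \<bar>s i j\<bar> = 1)
       \<and> (i \<noteq> j \<longrightarrow> (\<Sum>d<n. s i d * s j d) = 0))"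

lemma sum_lessThan_add:
  fixes f :: "nat \<Rightarrow> 'a :: comm_monoid_add"
  shows "(\<Sum>d<m + n. f d) = (\<Sum>d<m. f d) + (\<Sum>d<n. f (m + d))"
  by (induction n) (simp_all add: add.assoc)

text \<open>With I the identity, the blocks S + I and S - I are negative transposes of each other.
  Rows within one half have inner products twice those of S plus or minus an entry of S + S^T, and
  rows from different halves give an entry of -(S + S^T); distinct rows are therefore
  orthogonal.\<close>

lemma skew_conference_double:
  assumes "skew_conference n s"
  shows "\<exists>t. skew_conference (n + n) t"
proof -
  have skew: "s j i = - s i j" if "i < n" "j < n" for i j
    using assms that unfolding skew_conference_def by blast
  have diag: "s i i = 0" if "i < n" for i
    using skew[OF that that] by linarith
  have unit: "\<bar>s i j\<bar> = 1" if "i < n" "j < n" "i \<noteq> j" for i j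
    using assms that unfolding skew_conference_def by blast
  have unit': "\<bar>s i j + of_bool (i = j)\<bar> = 1" "\<bar>s i j - of_bool (i = j)\<bar> = 1" if "i < n" "j < n" for i j
    using that by (cases "i = j"; simp add: diag unit)+
  have orth: "(\<Sum>d<n. s i d * s j d) = 0" if "i < n" "j < n" "i \<noteq> j" for i j
    using assms that unfolding skew_conference_def by blast
  have delta: "(\<Sum>d<n. of_bool (j = d) * x d) = x j" if "j < n" for x :: "nat \<Rightarrow> int" and j
  proof -
    have "(\<Sum>d<n. of_bool (j = d) * x d) = (\<Sum>d<n. if j = d then x d else 0)"
      by (rule sum.cong) auto
    then show ?thesis using that by simp
  qed
  (* in block form [[S, S + I], [S - I, - S]] *)
  define t :: "nat \<Rightarrow> nat \<Rightarrow> int" where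
    "t i j = (if i < n then if j < n then s i j else s i (j - n) + of_bool (i = j - n)
      else if j < n then s (i - n) j - of_bool (i - n = j) else - s (i - n) (j - n))" for i j
  have t: "t i j = s i j" "t i (n + j) = s i j + of_bool (i = j)"
    "t (n + i) j = s i j - of_bool (i = j)" "t (n + i) (n + j) = - s i j"
    if "i < n" "j < n" for i j
    using that by (simp_all add: t_def)
  \<comment> \<open>The case \<open>i = j\<close> is included, since rows \<open>i\<close> and
    \<open>n + i\<close> are distinct.\<close>
  have low_high: "(\<Sum>d<n + n. t i d * t (n + j) d) = 0" if "i < n" "j < n" for i j
  proof -
    have "(\<Sum>d<n + n. t i d * t (n + j) d) = (\<Sum>d<n. s i d * (s j d - of_bool (j = d)))
        + (\<Sum>d<n. (s i d + of_bool (i = d)) * (- s j d))"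
      using that by (simp add: sum_lessThan_add t)
    also have "\<dots> = - (\<Sum>d<n. of_bool (j = d) * s i d) - (\<Sum>d<n. of_bool (i = d) * s j d)"
      by (simp add: algebra_simps sum.distrib sum_subtractf sum_negf)
    also have "\<dots> = 0" using that skew[of i j] by (simp add: delta)
    finally show ?thesis .
  qed
  have low_low: "(\<Sum>d<n + n. t i d * t j d) = 0" if "i < n" "j < n" "i \<noteq> j" for i j
  proof -
    have "(\<Sum>d<n + n. t i d * t j d) = (\<Sum>d<n. s i d * s j d)
        + (\<Sum>d<n. (s i d + of_bool (i = d)) * (s j d + of_bool (j = d)))"
      using that by (simp add: sum_lessThan_add t)
    also have "(\<Sum>d<n. (s i d + of_bool (i = d)) * (s j d + of_bool (j = d)))
        = (\<Sum>d<n. s i d * s j d + of_bool (j = d) * s i d + of_bool (i = d) * s j d)"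
      by (rule sum.cong) (use that(3) in \<open>auto simp: algebra_simps\<close>)
    also have "\<dots> = (\<Sum>d<n. s i d * s j d) + s i j + s j i"
      using that by (simp only: sum.distrib delta)
    finally show ?thesis using skew[OF that(1,2)] orth[OF that] by linarith
  qed
  have high_high: "(\<Sum>d<n + n. t (n + i) d * t (n + j) d) = 0" if "i < n" "j < n" "i \<noteq> j" for i j
  proof -
    have "(\<Sum>d<n + n. t (n + i) d * t (n + j) d) = (\<Sum>d<n. s i d * s j d)
        + (\<Sum>d<n. (s i d - of_bool (i = d)) * (s j d - of_bool (j = d)))"
      using that by (simp add: sum_lessThan_add t)
    also have "(\<Sum>d<n. (s i d - of_bool (i = d)) * (s j d - of_bool (j = d)))
        = (\<Sum>d<n. s i d * s j d - of_bool (j = d) * s i d - of_bool (i = d) * s j d)"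
      by (rule sum.cong) (use that(3) in \<open>auto simp: algebra_simps\<close>)
    also have "\<dots> = (\<Sum>d<n. s i d * s j d) - s i j - s j i"
      using that by (simp only: sum_subtractf delta)
    finally show ?thesis using skew[OF that(1,2)] orth[OF that] by linarith
  qed
  have split: "i < n \<or> (\<exists>i'. i = n + i' \<and> i' < n)" if "i < n + n" for i
    using that by (metis add_less_cancel_left le_Suc_ex not_le)
  have "t j i = - t i j" if "i < n + n" "j < n + n" for i j
    using split[OF that(1)] split[OF that(2)]
      skew[of i j] skew[of i "j - n"] skew[of "i - n" j] skew[of "i - n" "j - n"]
    by (elim disjE exE conjE; simp add: t)
  moreover have "\<bar>t i j\<bar> = 1" if "i < n + n" "j < n + n" "i \<noteq> j" for i j
    using split[OF that(1)] split[OF that(2)] that(3) by (auto simp: t unit unit')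
  moreover have "(\<Sum>d<n + n. t i d * t j d) = 0" if ij: "i < n + n" "j < n + n" "i \<noteq> j" for i j
    using split[OF ij(1)] split[OF ij(2)]
  proof (elim disjE exE conjE)
    fix i' assume "j < n" "i = n + i'" "i' < n"
    then show ?thesis using low_high[of j i'] by (simp add: mult.commute)
  qed (use ij(3) low_high low_low high_high in auto)
  ultimately have "skew_conference (n + n) t"
    unfolding skew_conference_def by blast
  then show ?thesis by blast
qed

lemma skew_conference_power_2: "\<exists>s. skew_conference (2 ^ m) s"
proof (induction m)
  case 0
  show ?case by (rule exI[of _ "\<lambda>_ _. 0"]) (simp add: skew_conference_def)
next
  case (Suc m)
  then show ?case using skew_conference_double by (auto simp flip: mult_2)
qed

section \<open>The Pfaffian hypergraph\<close>

(* Equivalently, the Pfaffian of the skew 4 x 4 submatrix on a, b, c, d is 3 or -3. *)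
definition equal_pfaffian_terms :: "(nat \<Rightarrow> nat \<Rightarrow> int) \<Rightarrow> nat \<Rightarrow> nat \<Rightarrow> nat \<Rightarrow> nat \<Rightarrow> bool" where
  "equal_pfaffian_terms s a b c d \<longleftrightarrow>
     s a b * s c d = - (s a c * s b d) \<and> s a b * s c d = s a d * s b c"

definition pfaffian_edges :: "nat \<Rightarrow> (nat \<Rightarrow> nat \<Rightarrow> int) \<Rightarrow> nat set set" where
  "pfaffian_edges n s = {{a, b, c, d} | a b c d.
     {a, b, c, d} \<in> [{..<n}]\<^bsup>4\<^esup> \<and> equal_pfaffian_terms s a b c d}"

lemma abs_one_mult_self: "\<bar>x\<bar> = 1 \<Longrightarrow> x * x = (1 :: int)"
  by (metis abs_mult_self_eq mult_1_right)

context
  fixes n s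
  assumes conf: "skew_conference n s"
begin

lemma skew: "\<lbrakk>i < n; j < n\<rbrakk> \<Longrightarrow> s j i = - s i j"
  and unit: "\<lbrakk>i < n; j < n; i \<noteq> j\<rbrakk> \<Longrightarrow> \<bar>s i j\<bar> = 1"
  and orth: "\<lbrakk>i < n; j < n; i \<noteq> j\<rbrakk> \<Longrightarrow> (\<Sum>d<n. s i d * s j d) = 0"
  using conf unfolding skew_conference_def by blast+

lemma diag: "i < n \<Longrightarrow> s i i = 0"
  using skew[of i i] by linarith

text \<open>An adjacent transposition negates and permutes the three terms of the Pfaffian, so their
  equality is preserved.\<close>

lemma equal_pfaffian_terms_swap:
  assumes "a < n" "b < n" "c < n" "d < n"
  shows "equal_pfaffian_terms s b a c d \<longleftrightarrow> equal_pfaffian_terms s a b c d"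
    and "equal_pfaffian_terms s a c b d \<longleftrightarrow> equal_pfaffian_terms s a b c d"
    and "equal_pfaffian_terms s a b d c \<longleftrightarrow> equal_pfaffian_terms s a b c d"
  using assms skew[of a b] skew[of b c] skew[of c d]
  by (auto simp: equal_pfaffian_terms_def mult.commute)

text \<open>The ordering hidden in the existential definition of \<open>pfaffian_edges\<close> is
  immaterial, because adjacent transpositions generate all orderings.\<close>

lemma insert4_in_pfaffian_edges:
  assumes "{a, b, c, d} \<in> [{..<n}]\<^bsup>4\<^esup>"
  shows "{a, b, c, d} \<in> pfaffian_edges n s \<longleftrightarrow> equal_pfaffian_terms s a b c d"
proof
  assume "{a, b, c, d} \<in> pfaffian_edges n s"
  then obtain a' b' c' d' where eq: "{a, b, c, d} = {a', b', c', d'}"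
    and P: "equal_pfaffian_terms s a' b' c' d'"
    unfolding pfaffian_edges_def by blast
  have less: "a < n" "b < n" "c < n" "d < n"
    using assms unfolding nsets_4_distinct by simp_all
  have dist: "a' \<noteq> b'" "a' \<noteq> c'" "a' \<noteq> d'" "b' \<noteq> c'" "b' \<noteq> d'" "c' \<noteq> d'"
    using assms unfolding eq nsets_4_distinct by simp_all
  have "a' = a \<or> a' = b \<or> a' = c \<or> a' = d" "b' = a \<or> b' = b \<or> b' = c \<or> b' = d"
    "c' = a \<or> c' = b \<or> c' = c \<or> c' = d" "d' = a \<or> d' = b \<or> d' = c \<or> d' = d"
    using eq by blast+
  then show "equal_pfaffian_terms s a b c d"
    using P dist
    by (elim disjE; simp only: simp_thms equal_pfaffian_terms_swap less)
next
  assume "equal_pfaffian_terms s a b c d"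
  then show "{a, b, c, d} \<in> pfaffian_edges n s"
    using assms unfolding pfaffian_edges_def by blast
qed

lemma pfaffian_edges_nsets: "pfaffian_edges n s \<subseteq> [{..<n}]\<^bsup>4\<^esup>"
  unfolding pfaffian_edges_def by blast

text \<open>For signs p, q, r the expression 1 + pq + pr + qr is 4 if all three agree and 0
  otherwise. With the three Pfaffian terms as p, q, r, summing over d turns each product into an
  inner product of two rows.\<close>

lemma pfaffian_edges_codegree:
  assumes abc: "a < n" "b < n" "c < n" "a \<noteq> b" "a \<noteq> c" "b \<noteq> c"
  shows "4 * (\<Sum>d<n. of_bool ({a, b, c, d} \<in> pfaffian_edges n s)) = int n"
proof -
  let ?W = "{..<n} - {a, b, c}"
  have sum_W: "sum f ?W = sum f {..<n} - f a - f b - f c" for f :: "nat \<Rightarrow> int"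
    using abc by (simp add: sum_diff)
  \<comment> \<open>The full row products vanish. Of the three omitted indices only one contributes,
    because the diagonal is zero.\<close>
  have rows: "(\<Sum>d\<in>?W. s b d * s c d) = - (s a b * s a c)"
    "(\<Sum>d\<in>?W. s a d * s c d) = s a b * s b c"
    "(\<Sum>d\<in>?W. s a d * s b d) = - (s a c * s b c)"
    unfolding sum_W using abc orth diag skew[of a b] skew[of a c] skew[of b c] by simp_all
  have sq: "s a b * s a b = 1" "s a c * s a c = 1" "s b c * s b c = 1"
    using abc by (simp_all add: abs_one_mult_self unit)
  have term_eq: "4 * of_bool ({a, b, c, d} \<in> pfaffian_edges n s) =
      1 - s a b * s a c * (s b d * s c d) + s a b * s b c * (s a d * s c d)
        - s a c * s b c * (s a d * s b d)" if d: "d \<in> ?W" for d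
  proof -
    have pm: "x = 1 \<or> x = - 1" if "\<bar>x\<bar> = 1" for x :: int using that by linarith
    have "{a, b, c, d} \<in> [{..<n}]\<^bsup>4\<^esup>"
      using abc d unfolding nsets_4_distinct by auto
    note edge = insert4_in_pfaffian_edges[OF this, unfolded equal_pfaffian_terms_def]
    have "s a b = 1 \<or> s a b = - 1" "s a c = 1 \<or> s a c = - 1" "s b c = 1 \<or> s b c = - 1"
      "s a d = 1 \<or> s a d = - 1" "s b d = 1 \<or> s b d = - 1" "s c d = 1 \<or> s c d = - 1"
      using abc d by (auto intro!: pm unit)
    then show ?thesis
      unfolding edge by (elim disjE; simp)
  qed
  have "4 * (\<Sum>d<n. of_bool ({a, b, c, d} \<in> pfaffian_edges n s)) =
      4 * (\<Sum>d\<in>?W. of_bool ({a, b, c, d} \<in> pfaffian_edges n s) :: int)"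
  proof -
    have "{a, b, c, d} \<notin> pfaffian_edges n s" if "d \<notin> ?W" "d < n" for d
    proof
      assume "{a, b, c, d} \<in> pfaffian_edges n s"
      then have "{a, b, c, d} \<in> [{..<n}]\<^bsup>4\<^esup>" by (rule subsetD[OF pfaffian_edges_nsets])
      then show False using that unfolding nsets_4_distinct by simp
    qed
    then have "(\<Sum>d\<in>?W. of_bool ({a, b, c, d} \<in> pfaffian_edges n s) :: int)
        = (\<Sum>d<n. of_bool ({a, b, c, d} \<in> pfaffian_edges n s))"
      by (intro sum.mono_neutral_left) auto
    then show ?thesis by simp
  qed
  also have "\<dots> = (\<Sum>d\<in>?W. 1 - s a b * s a c * (s b d * s c d) + s a b * s b c * (s a d * s c d)
        - s a c * s b c * (s a d * s b d))"
    unfolding sum_distrib_left by (rule sum.cong[OF refl term_eq])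
  also have "\<dots> = card ?W - s a b * s a c * - (s a b * s a c) + s a b * s b c * (s a b * s b c)
        - s a c * s b c * - (s a c * s b c)"
    unfolding sum.distrib sum_subtractf sum_distrib_left[symmetric] rows by simp
  also have "\<dots> = card ?W + (s a b * s a b) * (s a c * s a c) + (s a b * s a b) * (s b c * s b c)
        + (s a c * s a c) * (s b c * s b c)"
    by (simp add: mult_ac)
  also have "\<dots> = int (card ?W) + 3" unfolding sq by simp
  also have "card ?W = n - 3"
    using abc by (simp add: card_Diff_subset)
  also have "int (n - 3) + 3 = int n" using abc by linarith
  finally show ?thesis .
qed

text \<open>Codegrees over the 6 (n choose 3) ordered triples sum to 24 times the number of edges,
  and each equals n/4.\<close>

lemma card_pfaffian_edges: "real (card (pfaffian_edges n s)) = real n / 16 * real (n choose 3)"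
proof -
  let ?E = "pfaffian_edges n s"
  let ?deg = "\<lambda>a b c. (\<Sum>d<n. of_bool ({a, b, c, d} \<in> ?E)) :: real"
  have zero: "?deg a b c = 0" if "a = b \<or> c = a \<or> c = b" for a b c
  proof -
    have "{a, b, c, d} \<notin> ?E" for d
    proof
      assume "{a, b, c, d} \<in> ?E"
      then have "{a, b, c, d} \<in> [{..<n}]\<^bsup>4\<^esup>" by (rule subsetD[OF pfaffian_edges_nsets])
      then show False using that unfolding nsets_4_distinct by auto
    qed
    then show ?thesis by simp
  qed
  have deg: "?deg a b c = n / 4" if "a < n" "b < n" "c < n" "a \<noteq> b" "a \<noteq> c" "b \<noteq> c" for a b c
  proof -
    have "real_of_int (4 * (\<Sum>d<n. of_bool ({a, b, c, d} \<in> ?E))) = n"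
      using pfaffian_edges_codegree[OF that] by simp
    then show ?thesis by simp
  qed
  have "24 * real (card ?E) = (\<Sum>a<n. \<Sum>b<n. \<Sum>c<n. ?deg a b c)"
    by (rule sum_of_bool_insert4[symmetric]) (use pfaffian_edges_nsets in simp_all)
  also have "\<dots> = (\<Sum>a<n. \<Sum>b\<in>{..<n} - {a}. \<Sum>c\<in>{..<n} - {a, b}. ?deg a b c)"
    by (rule sum_distinct3[symmetric]) (use zero in simp_all)
  also have "\<dots> = (\<Sum>a<n. \<Sum>b\<in>{..<n} - {a}. \<Sum>c\<in>{..<n} - {a, b}. n / 4)"
    by (intro sum.cong refl deg) auto
  also have "\<dots> = 6 * real (n choose 3) * (n / 4)"
    using sum_distinct3_const[of "{..<n}" "n / 4"] by simp
  finally show ?thesis by simp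
qed

(* The link of a, b is bipartite, with classes given by the sign of s a x * s b x. *)
lemma pfaffian_edges_link_sign:
  assumes "{a, b, x, y} \<in> pfaffian_edges n s"
  shows "s a y * s b y = - (s a x * s b x)" "s a x * s b x \<noteq> 0"
proof -
  have N: "{a, b, x, y} \<in> [{..<n}]\<^bsup>4\<^esup>" using assms pfaffian_edges_nsets by blast
  then have "equal_pfaffian_terms s a b x y"
    using assms insert4_in_pfaffian_edges by blast
  then have eq: "s a y * s b x = - (s a x * s b y)"
    by (simp add: equal_pfaffian_terms_def)
  have "\<bar>s a x\<bar> = 1" "\<bar>s b x\<bar> = 1" "\<bar>s b y\<bar> = 1"
    using N unfolding nsets_4_distinct by (auto intro: unit)
  then have sq: "s b x * s b x = 1" "s b y * s b y = 1" and ne: "s a x \<noteq> 0" "s b x \<noteq> 0"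
    by (auto intro: abs_one_mult_self)
  have "s a y * s b y = (s a y * s b x) * (s b x * s b y)" using sq(1) by (simp add: algebra_simps)
  also have "\<dots> = - (s a x * s b x)" unfolding eq using sq(2) by (simp add: algebra_simps)
  finally show "s a y * s b y = - (s a x * s b x)" .
  show "s a x * s b x \<noteq> 0" using ne by simp
qed

text \<open>In the link of the two suspension vertices, \<open>sign\<close> flips along each edge.
  Going once around an odd cycle would make a nonzero integer equal to its negative.\<close>

lemma pfaffian_edges_suspension_free:
  "\<not> contains_copy ({..<n}, pfaffian_edges n s) (suspension 4 (cycle_graph (2 * k + 1)))"
proof
  let ?F = "suspension 4 (cycle_graph (2 * k + 1))"
  assume "contains_copy ({..<n}, pfaffian_edges n s) ?F"
  then obtain f where f: "\<And>e. e \<in> edges ?F \<Longrightarrow> f ` e \<in> pfaffian_edges n s"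
    unfolding contains_copy_def by auto
  define a b where "a = f (Inr 0)" and "b = f (Inr 1)"
  define sign where "sign i = s a (f (Inl i)) * s b (f (Inl i))" for i
  have two: "{..<2 :: nat} = {0, 1}" by auto
  have edge: "{a, b, f (Inl i), f (Inl ((i + 1) mod (2 * k + 1)))} \<in> pfaffian_edges n s"
    if "i < 2 * k + 1" for i
  proof -
    have "{i, (i + 1) mod (2 * k + 1)} <+> {..<2} \<in> edges ?F"
      using that by (auto simp: suspension_def cycle_graph_def)
    moreover have "f ` ({i, (i + 1) mod (2 * k + 1)} <+> {..<2 :: nat})
        = {a, b, f (Inl i), f (Inl ((i + 1) mod (2 * k + 1)))}"
      by (auto simp: a_def b_def two Plus_def image_Un)
    ultimately show ?thesis using f by metis
  qed
  have step: "sign ((i + 1) mod (2 * k + 1)) = - sign i" "sign i \<noteq> 0" if "i < 2 * k + 1" for i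
    using pfaffian_edges_link_sign[OF edge[OF that]] by (simp_all add: sign_def)
  have alternate: "sign i = (- 1) ^ i * sign 0" if "i \<le> 2 * k" for i
    using that
  proof (induction i)
    case (Suc i)
    then show ?case using step(1)[of i] by simp
  qed simp
  have "sign (2 * k) = sign 0" using alternate[of "2 * k"] by simp
  moreover have "sign 0 = - sign (2 * k)" using step(1)[of "2 * k"] by simp
  ultimately show False using step(2)[of 0] by simp
qed

end

subsection \<open>The extremal number\<close>

context
  fixes n m :: nat
  assumes m: "m \<ge> 1"
begin

definition free_edge_counts :: "nat set" where
  "free_edge_counts = {card (edges H) | H :: nat hypergraph.
     uniform_hypergraph 4 H \<and> card (verts H) = n \<and> \<not> contains_copy H (suspension 4 (cycle_graph m))}"

lemma finite_free_edge_counts: "finite free_edge_counts"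
proof (rule finite_subset[of _ "{..n choose 4}"])
  have "card (edges H) \<le> card (verts H) choose 4" if "uniform_hypergraph 4 H" for H :: "nat hypergraph"
    using that card_mono[of "[verts H]\<^bsup>4\<^esup>" "edges H"]
    by (simp add: uniform_hypergraph_def finite_imp_finite_nsets)
  then show "free_edge_counts \<subseteq> {..n choose 4}"
    by (auto simp: free_edge_counts_def)
qed simp

lemma ex_eq_Max: "ex 4 n (suspension 4 (cycle_graph m)) = Max free_edge_counts"
  by (simp add: ex_def free_edge_counts_def)

text \<open>Witnessed by the edgeless hypergraph. Together with finiteness it ensures that the
  \<open>Max\<close> in \<open>ex\<close> is attained.\<close>

lemma free_edge_counts_nonempty: "free_edge_counts \<noteq> {}"
proof -
  have "edges (suspension 4 (cycle_graph m)) \<noteq> {}"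
    using m by (auto simp: suspension_def cycle_graph_def Suc_le_eq)
  then have "\<not> contains_copy ({..<n}, {}) (suspension 4 (cycle_graph m))"
    by (auto simp: contains_copy_def)
  then show ?thesis
    unfolding free_edge_counts_def uniform_hypergraph_def by fastforce
qed

lemma ex_attained:
  obtains H :: "nat hypergraph" where "uniform_hypergraph 4 H" "card (verts H) = n"
    "\<not> contains_copy H (suspension 4 (cycle_graph m))"
    "ex 4 n (suspension 4 (cycle_graph m)) = card (edges H)"
proof -
  have "ex 4 n (suspension 4 (cycle_graph m)) \<in> free_edge_counts"
    unfolding ex_eq_Max by (rule Max_in[OF finite_free_edge_counts free_edge_counts_nonempty])
  then obtain H :: "nat hypergraph" where "uniform_hypergraph 4 H" "card (verts H) = n"
    "\<not> contains_copy H (suspension 4 (cycle_graph m))"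
    "ex 4 n (suspension 4 (cycle_graph m)) = card (edges H)"
    unfolding free_edge_counts_def by blast
  then show ?thesis by (rule that)
qed

lemma card_edges_le_ex:
  fixes H :: "nat hypergraph"
  assumes "uniform_hypergraph 4 H" "card (verts H) = n"
    "\<not> contains_copy H (suspension 4 (cycle_graph m))"
  shows "card (edges H) \<le> ex 4 n (suspension 4 (cycle_graph m))"
  unfolding ex_eq_Max
  by (rule Max_ge[OF finite_free_edge_counts]) (use assms in \<open>unfold free_edge_counts_def, blast\<close>)

end

theorem theorem1p4:
  fixes k :: nat
  assumes "k \<ge> 1"
  shows "(\<exists>n0. \<forall>n\<ge>n0.
            real (ex 4 n (suspension 4 (cycle_graph (2 * k + 1)))) \<le> real n / 16 * real (n choose 3))
       \<and> infinite {n. real (ex 4 n (suspension 4 (cycle_graph (2 * k + 1)))) = real n / 16 * real (n choose 3)}"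
proof -
  let ?F = "suspension 4 (cycle_graph (2 * k + 1))"
  have m: "2 * k + 1 \<ge> 1" by simp
  obtain n0 where n0: "\<And>n (W :: nat set) R. \<lbrakk>n \<ge> n0; finite_graph W R; card W + 2 = n;
      \<not> finite_graph.has_cycle W R (2 * k + 1)\<rbrakk> \<Longrightarrow>
      3 / 2 * (\<Sum>x\<in>W. real (card (finite_graph.triangles_at W R x)))
      \<le> (\<Sum>x\<in>W. (real (card (finite_graph.nbrs W R x)) - n / 4)\<^sup>2)"
    using three_halves_triangles_le[OF assms] by blast
  have upper: "real (ex 4 n ?F) \<le> real n / 16 * real (n choose 3)" if n: "n \<ge> n0" for n
  proof -
    obtain V :: "nat set" and E where H: "uniform_hypergraph 4 (V, E)" "card V = n"
      "\<not> contains_copy (V, E) ?F" "ex 4 n ?F = card E"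
      using ex_attained[OF m] by (metis prod.collapse)
    then have V: "finite V" and E: "E \<subseteq> [V]\<^bsup>4\<^esup>"
      by (simp_all add: uniform_hypergraph_def)
    have "real (card E) \<le> card V / 16 * real (card V choose 3)"
    proof (rule card_edges_le_of_links[OF V E])
      fix a b assume ab: "a \<in> V" "b \<in> V" "a \<noteq> b"
      have "card {a, b} \<le> card V" by (rule card_mono) (use V ab in auto)
      then have "card (V - {a, b}) + 2 = n"
        using V ab H(2) by (simp add: card_Diff_subset)
      then show "3 / 2 * (\<Sum>x\<in>V - {a, b}. real (card (finite_graph.triangles_at (V - {a, b}) (link E a b) x)))
        \<le> (\<Sum>x\<in>V - {a, b}. (real (card (finite_graph.nbrs (V - {a, b}) (link E a b) x)) - card V / 4)\<^sup>2)"
        unfolding H(2)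
        by (intro n0[OF n] finite_graph_link[OF V E] link_no_cycle[OF E H(3) m ab V])
    qed
    then show ?thesis using H by simp
  qed
  \<comment> \<open>The exponent itself is taken at least \<open>n0\<close>: then
    \<open>2 ^ l\<close> exceeds \<open>n0\<close> as well and the upper bound applies.\<close>
  have sharp: "real (ex 4 (2 ^ l) ?F) = real (2 ^ l) / 16 * real (2 ^ l choose 3)" if l: "l \<ge> n0" for l
  proof (rule antisym)
    have "l \<le> 2 ^ l" by (rule less_imp_le) simp
    then show "real (ex 4 (2 ^ l) ?F) \<le> real (2 ^ l) / 16 * real (2 ^ l choose 3)"
      using upper[of "2 ^ l"] l by linarith
    obtain s where s: "skew_conference (2 ^ l) s" using skew_conference_power_2 by blast
    have "card (edges ({..<2 ^ l}, pfaffian_edges (2 ^ l) s)) \<le> ex 4 (2 ^ l) ?F"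
      by (rule card_edges_le_ex[OF m])
        (use pfaffian_edges_nsets[OF s] pfaffian_edges_suspension_free[OF s]
          in \<open>simp_all add: uniform_hypergraph_def\<close>)
    then have "real (card (pfaffian_edges (2 ^ l) s)) \<le> real (ex 4 (2 ^ l) ?F)" by simp
    then show "real (2 ^ l) / 16 * real (2 ^ l choose 3) \<le> real (ex 4 (2 ^ l) ?F)"
      unfolding card_pfaffian_edges[OF s] .
  qed
  have "inj_on (\<lambda>l. 2 ^ l :: nat) {n0..}" by (rule inj_onI) simp
  then have "infinite ((\<lambda>l. 2 ^ l :: nat) ` {n0..})"
    using finite_imageD infinite_Ici by blast
  moreover have "(\<lambda>l. 2 ^ l) ` {n0..} \<subseteq> {n. real (ex 4 n ?F) = real n / 16 * real (n choose 3)}"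
    using sharp by blast
  ultimately show ?thesis using upper infinite_super by blast
qed

end
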